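(* Let $c,k$ be fixed positive integers with $c\le k$, let $t>0$ be a real constant, and let $s=s(n)$ be an integer-valued function with $s(n)\ge c$ for all $n$. If $s(n)\sim t\,n^{1/c^2}$ as $n\to\infty$, then $$\lim_{n\to\infty}p(n,c,k,s(n))=e^{-\binom{k}{c}t^{-c^2}(c!)^c}.$$
   Context: $C_n^k$ denotes the $k$-th power of the cycle on $n$ vertices: its vertex set is $\{0,\ldots,n-1\}$, and distinct vertices $i,j$ are adjacent iff $(i-j) \bmod n\in\{-k,\ldots,-1,1,\ldots,k\}$ (residues modulo $n$), i.e. iff their distance along the cycle is at most $k$. Given a set $L(x)$ of colours for each vertex $x$ of a graph $G$, an $L$-colouring of $G$ is a map $f$ from $V(G)$ to the colours with $f(x)\in L(x)$ for all $x\in V(G)$ and $f(x)\ne f(y)$ for every edge $(x,y)\in E(G)$; $G$ is $L$-colourable if it has an $L$-colouring. Let $\mathcal{S}$ be a set of colours of size $s(n)$. For each vertex of $C_n^k$, independently, draw a subset of $\mathcal{S}$ of size $c$ uniformly at random among all $c$-element subsets of $\mathcal{S}$; this gives a random list assignment $L$. Then $p(n,c,k,s(n))$ is the probability that $C_n^k$ is $L$-colourable. The parameters $c,k,t$ are fixed and all asymptotics are as $n\to\infty$; $f\sim g$ means $\lim_{n\to\infty} f/g=1$. *)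

theory Defs
  imports "HOL-Probability.Probability" "Graph_Theory.Pair_Digraph"
begin

text \<open>Simple graphs are symmetric loop-free digraphs (locale \<^locale>\<open>pair_graph\<close>).\<close>

definition cycle_power :: "nat \<Rightarrow> nat \<Rightarrow> nat pair_pre_digraph" where
  "cycle_power n k =
     \<lparr> pverts = {0..<n},
       parcs = {(i, j). i \<in> {0..<n} \<and> j \<in> {0..<n} \<and> i \<noteq> j \<and>
                 (int i - int j) mod int n \<in>
                   (\<lambda>d. d mod int n) ` ({- int k..-1} \<union> {1..int k})} \<rparr>"

lemma pair_graph_cycle_power: "pair_graph (cycle_power n k)"
proof
  show "finite (pverts (cycle_power n k))"
    by (simp add: cycle_power_def)
  show "finite (parcs (cycle_power n k))"
    by (rule finite_subset[of _ "{0..<n} \<times> {0..<n}"]) (auto simp: cycle_power_def)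
  have sym: "(j, i) \<in> parcs (cycle_power n k)" if "(i, j) \<in> parcs (cycle_power n k)" for i j
  proof -
    from that obtain d where d: "d \<in> {- int k..-1} \<union> {1..int k}"
      and eq: "(int i - int j) mod int n = d mod int n"
      unfolding cycle_power_def by fastforce
    have "(int j - int i) mod int n = (- d) mod int n"
      using mod_minus_cong[OF eq] by simp
    moreover have "- d \<in> {- int k..-1} \<union> {1..int k}"
      using d by auto
    ultimately show ?thesis
      using that by (auto simp: cycle_power_def)
  qed
  show "symmetric (with_proj (cycle_power n k))"
    using sym by (auto simp: symmetric_def arcs_ends_def arc_to_ends_def intro!: symI)
qed (auto simp: cycle_power_def)

definition is_list_colouring ::
    "'v pair_pre_digraph \<Rightarrow> ('v \<Rightarrow> 'a set) \<Rightarrow> ('v \<Rightarrow> 'a) \<Rightarrow> bool" where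
  "is_list_colouring G L f \<longleftrightarrow>
     (\<forall>x\<in>pverts G. f x \<in> L x) \<and> (\<forall>(x, y)\<in>parcs G. f x \<noteq> f y)"

definition list_colourable :: "'v pair_pre_digraph \<Rightarrow> ('v \<Rightarrow> 'a set) \<Rightarrow> bool" where
  "list_colourable G L \<longleftrightarrow> (\<exists>f. is_list_colouring G L f)"

text \<open>
  Independent uniform \<open>c\<close>-subsets of \<open>S\<close> on the vertices of \<open>G\<close>; the default value \<open>{}\<close>
  outside the vertex set is irrelevant for list colourability. This is meaningful only for
  finite \<open>S\<close> with \<open>c \<le> card S\<close>, so that there is at least one subset to draw.
\<close>

definition random_lists :: "'v pair_pre_digraph \<Rightarrow> nat \<Rightarrow> 'a set \<Rightarrow> ('v \<Rightarrow> 'a set) pmf" where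
  "random_lists G c S =
     Pi_pmf (pverts G) {} (\<lambda>_. pmf_of_set {A. A \<subseteq> S \<and> card A = c})"

text \<open>
  The probability is parametrised by the colour set \<open>S\<close> itself instead of its size,
  so that the set of colours can be any set of the prescribed size.
\<close>

definition colourable_prob :: "nat \<Rightarrow> nat \<Rightarrow> nat \<Rightarrow> 'a set \<Rightarrow> real" where
  "colourable_prob n c k S =
     measure_pmf.prob (random_lists (cycle_power n k) c S)
       {L. list_colourable (cycle_power n k) L}"

end

theory Submission
  imports Defs
begin

text \<open>
  Let \<open>q = 1 / (s choose c) ^ c\<close> be the probability that \<open>c + 1\<close> given vertices receive the same list, and
  call a \<open>(c + 1)\<close>-clique constant if its vertices do so. A constant clique makes the graph
  uncolourable. Conversely, consider an uncolourable induced subgraph that is minimal. Any cut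
  of it is crossed by an edge whose endpoints share a colour, so it can be explored from one
  vertex with each new vertex reusing a colour: either some ball of radius \<open>c\<^sup>2 + 1\<close> carries at
  least \<open>c\<^sup>2 + 1\<close> fewer colours than it has list entries, which has probability
  \<open>O(n / s ^ (c\<^sup>2 + 1)) = o(1)\<close>, or the subgraph lies inside a ball with at most \<open>c\<^sup>2\<close> repetitions. In the
  latter case a set violating Hall's condition yields \<open>c + 1\<close> vertices with equal lists, and
  they must form a clique.

  There are \<open>n (k choose c)\<close> cliques, and revealing them one at a time multiplies the probability
  that none of them is constant by \<open>exp (- q)\<close> up to an error \<open>o(1 / n)\<close>, because a clique is
  independent of all but boundedly many others, and two distinct intersecting cliques are
  simultaneously constant with probability at most \<open>q / (s choose c)\<close>.
\<close>

subsection \<open>Obstructions to list colouring\<close>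

text \<open>Induction on \<open>I\<close>. If a proper nonempty subfamily is tight, with exactly as
  many colours as members, it is matched first and its colours are deleted elsewhere. If none is
  tight, every proper nonempty subfamily has a colour to spare, so any colour chosen for one member
  may be deleted from the other lists.\<close>

lemma hall_marriage:
  fixes L :: "'v \<Rightarrow> 'a set"
  assumes "finite I" and "\<And>i. i \<in> I \<Longrightarrow> finite (L i)"
    and "\<And>J. J \<subseteq> I \<Longrightarrow> card J \<le> card (\<Union>(L ` J))"
  obtains f where "inj_on f I" and "\<And>i. i \<in> I \<Longrightarrow> f i \<in> L i"
proof -
  have "\<exists>f. inj_on f I \<and> (\<forall>i\<in>I. f i \<in> L i)"
    using assms
  proof (induction I arbitrary: L rule: finite_psubset_induct)
    case (psubset I)
    note fin = psubset.prems(1) and hall = psubset.prems(2)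
    show ?case
    proof (cases "I = {}")
      case False
      then obtain i where i: "i \<in> I" by blast
      show ?thesis
      proof (cases "\<exists>J. J \<subset> I \<and> J \<noteq> {} \<and> card (\<Union>(L ` J)) = card J")
        case True
        then obtain J where J: "J \<subset> I" "J \<noteq> {}" "card (\<Union>(L ` J)) = card J" by blast
        let ?U = "\<Union>(L ` J)"
        have finJ: "finite J" using J(1) psubset.hyps by (meson finite_subset psubset_imp_subset)
        have finU: "finite ?U" using finJ fin J(1) by auto
        have "\<exists>f. inj_on f J \<and> (\<forall>i\<in>J. f i \<in> L i)"
          using J(1) fin hall by (intro psubset.IH) (auto)
        then obtain f where f: "inj_on f J" "\<forall>i\<in>J. f i \<in> L i" by blast
        have "\<exists>g. inj_on g (I - J) \<and> (\<forall>i\<in>I - J. g i \<in> L i - ?U)"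
        proof (rule psubset.IH)
          show "I - J \<subset> I" using J by blast
          show "finite (L i - ?U)" if "i \<in> I - J" for i using fin that by auto
          \<comment> \<open>Hall's condition for \<open>K \<union> J\<close>, minus the equality for
            the tight family \<open>J\<close>.\<close>
          show "card K \<le> card (\<Union>i\<in>K. L i - ?U)" if K: "K \<subseteq> I - J" for K
          proof -
            have finK: "finite K" using K psubset.hyps by (meson finite_Diff finite_subset)
            have fin': "finite (\<Union>i\<in>K. L i - ?U)" using finK K fin by auto
            have "card K + card J = card (K \<union> J)"
              using K finK finJ by (subst card_Un_disjoint) auto
            also have "\<dots> \<le> card (\<Union>(L ` (K \<union> J)))"
              using K J(1) by (intro hall) auto
            also have "\<Union>(L ` (K \<union> J)) = (\<Union>i\<in>K. L i - ?U) \<union> ?U" by auto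
            also have "card \<dots> \<le> card (\<Union>i\<in>K. L i - ?U) + card ?U" by (rule card_Un_le)
            finally show ?thesis using J(3) by simp
          qed
        qed
        then obtain g where g: "inj_on g (I - J)" "\<forall>i\<in>I - J. g i \<in> L i - ?U" by blast
        let ?h = "\<lambda>i. if i \<in> J then f i else g i"
        have sub: "f ` J \<subseteq> ?U" "g ` (I - J) \<subseteq> - ?U" using f(2) g(2) by blast+
        have "inj_on ?h J" using f(1) by (simp add: inj_on_def)
        moreover have "inj_on ?h (I - J)" using g(1) by (simp add: inj_on_def)
        moreover have "?h ` J \<inter> ?h ` (I - J) = {}" using sub by (auto simp: image_subset_iff)
        moreover have "J - (I - J) = J" "I - J - J = I - J" by blast+
        ultimately have "inj_on ?h (J \<union> (I - J))" unfolding inj_on_Un by simp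
        moreover have "J \<union> (I - J) = I" using J(1) by blast
        ultimately have "inj_on ?h I" by simp
        moreover have "\<forall>i\<in>I. ?h i \<in> L i" using f g by auto
        ultimately show ?thesis by blast
      next
        case no: False
        have "card {i} \<le> card (\<Union>(L ` {i}))" using i by (intro hall) auto
        then obtain a where a: "a \<in> L i" by fastforce
        have "\<exists>g. inj_on g (I - {i}) \<and> (\<forall>j\<in>I - {i}. g j \<in> L j - {a})"
        proof (rule psubset.IH)
          show "I - {i} \<subset> I" using i by blast
          show "finite (L j - {a})" if "j \<in> I - {i}" for j using fin that by auto
          show "card K \<le> card (\<Union>j\<in>K. L j - {a})" if K: "K \<subseteq> I - {i}" for K
          proof (cases "K = {}")
            case False
            have KI: "K \<subset> I" using K i by blast
            have "card K \<noteq> card (\<Union>(L ` K))" using no KI False by metis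
            moreover have "card K \<le> card (\<Union>(L ` K))" using KI by (intro hall) auto
            moreover have "(\<Union>j\<in>K. L j - {a}) = \<Union>(L ` K) - {a}" by auto
            moreover have "card (\<Union>(L ` K) - {a}) \<ge> card (\<Union>(L ` K)) - card {a}"
              by (rule diff_card_le_card_Diff) simp
            ultimately show ?thesis by simp
          qed simp
        qed
        then obtain g where g: "inj_on g (I - {i})" "\<forall>j\<in>I - {i}. g j \<in> L j - {a}" by blast
        have "inj_on (g(i := a)) I" using g by (auto simp: inj_on_def)
        moreover have "\<forall>j\<in>I. (g(i := a)) j \<in> L j" using g a by auto
        ultimately show ?thesis by blast
      qed
    qed simp
  qed
  thus ?thesis using that by blast
qed

section \<open>Minimal uncolourable induced subgraphs\<close>

definition colourable_on :: "('v \<times> 'v) set \<Rightarrow> ('v \<Rightarrow> 'a set) \<Rightarrow> 'v set \<Rightarrow> bool" where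
  "colourable_on E L H \<longleftrightarrow>
     (\<exists>f. (\<forall>x\<in>H. f x \<in> L x) \<and> (\<forall>x\<in>H. \<forall>y\<in>H. (x, y) \<in> E \<longrightarrow> f x \<noteq> f y))"

definition cliques :: "('v \<times> 'v) set \<Rightarrow> 'v set \<Rightarrow> nat \<Rightarrow> 'v set set" where
  "cliques E V m = {X. X \<subseteq> V \<and> card X = m \<and> (\<forall>x\<in>X. \<forall>y\<in>X. x \<noteq> y \<longrightarrow> (x, y) \<in> E)}"

text \<open>Powers of the reflexive closure allow idle steps, so walks of length at most
  \<open>r\<close> count, not only those of length exactly \<open>r\<close>.\<close>

abbreviation ball_of :: "('v \<times> 'v) set \<Rightarrow> nat \<Rightarrow> 'v \<Rightarrow> 'v set" where
  "ball_of E r v \<equiv> ((E\<^sup>=) ^^ r) `` {v}"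

lemma ball_of_Suc: "ball_of E (Suc r) v = ball_of E r v \<union> E `` ball_of E r v"
  by auto

lemma ball_of_mono: "r \<le> r' \<Longrightarrow> ball_of E r v \<subseteq> ball_of E r' v"
  by (rule lift_Suc_mono_le[of "\<lambda>r. ball_of E r v"]) (simp only: ball_of_Suc Un_upper1)

lemma clique_not_colourable:
  assumes "X \<in> cliques E V (Suc c)" and "\<And>x. x \<in> X \<Longrightarrow> L x = A" and "card A = c" "finite A"
  shows "\<not> colourable_on E L V"
proof
  assume "colourable_on E L V"
  then obtain f where f: "\<forall>x\<in>V. f x \<in> L x" "\<forall>x\<in>V. \<forall>y\<in>V. (x, y) \<in> E \<longrightarrow> f x \<noteq> f y"
    by (auto simp: colourable_on_def)
  have "f ` X \<subseteq> A" using f assms(1,2) by (fastforce simp: cliques_def)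
  moreover have "inj_on f X" using f(2) assms(1) unfolding cliques_def inj_on_def by blast
  ultimately have "card X \<le> card A" using assms(4) by (metis card_image card_mono)
  thus False using assms by (simp add: cliques_def)
qed

text \<open>A family of \<open>c + 1\<close> equal lists of size \<open>c\<close> has
  \<open>c * (c + 1)\<close> entries but only \<open>c\<close> colours, hence exactly
  \<open>c\<^sup>2\<close> repetitions. Hypothesis \<open>sparse\<close> permits no more than that
  inside a ball, so a minimal uncolourable set has no room for any obstruction other than equal
  lists on a clique.\<close>

lemma noncolourable_clique_constant:
  assumes V: "finite V" and E: "sym E" "irrefl E" and c: "c \<ge> 1"
    and L: "\<And>x. x \<in> V \<Longrightarrow> finite (L x) \<and> card (L x) = c"
    and sparse: "\<And>v A. v \<in> V \<Longrightarrow> A \<subseteq> V \<inter> ball_of E (Suc (c\<^sup>2)) v \<Longrightarrow>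
                   c * card A \<le> card (\<Union>(L ` A)) + c\<^sup>2"
    and nc: "\<not> colourable_on E L V"
  obtains X A where "X \<in> cliques E V (Suc c)" and "\<And>x. x \<in> X \<Longrightarrow> L x = A"
proof -
  have "finite {H. H \<subseteq> V \<and> \<not> colourable_on E L H}" using V by auto
  moreover have "V \<in> {H. H \<subseteq> V \<and> \<not> colourable_on E L H}" using nc by auto
  ultimately obtain H where H: "H \<subseteq> V" "\<not> colourable_on E L H"
    and Hmin: "\<And>H'. H' \<subset> H \<Longrightarrow> colourable_on E L H'"
    using finite_has_minimal2[of "{H. H \<subseteq> V \<and> \<not> colourable_on E L H}" V]
    by (smt (verit) mem_Collect_eq psubset_eq order_trans)
  have finH: "finite H" using H V finite_subset by blast
  have finL: "finite (\<Union>(L ` A))" if "A \<subseteq> H" for A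
    using that H L finH finite_subset[OF that] by (intro finite_UN_I) auto
  \<comment> \<open>Otherwise the colourings that minimality provides on \<open>A\<close> and on
    \<open>H - A\<close> cannot clash across the cut, and they glue to a colouring of
    \<open>H\<close>.\<close>
  have cut: "\<exists>x\<in>A. \<exists>y\<in>H - A. (x, y) \<in> E \<and> L x \<inter> L y \<noteq> {}" if A: "A \<subset> H" "A \<noteq> {}" for A
  proof (rule ccontr)
    assume no: "\<not> ?thesis"
    obtain f where f: "\<forall>x\<in>A. f x \<in> L x" "\<forall>x\<in>A. \<forall>y\<in>A. (x, y) \<in> E \<longrightarrow> f x \<noteq> f y"
      using Hmin[OF A(1)] by (auto simp: colourable_on_def)
    obtain g where g: "\<forall>x\<in>H - A. g x \<in> L x" "\<forall>x\<in>H - A. \<forall>y\<in>H - A. (x, y) \<in> E \<longrightarrow> g x \<noteq> g y"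
      using Hmin[of "H - A"] A unfolding colourable_on_def by blast
    have cross: "f x \<noteq> g y" if "x \<in> A" "y \<in> H - A" "(x, y) \<in> E" for x y
      using no f(1) g(1) that by (metis IntI empty_iff)
    have cross': "g y \<noteq> f x" if "x \<in> A" "y \<in> H - A" "(y, x) \<in> E" for x y
      using cross[OF that(1,2)] that(3) E(1) by (metis symD)
    have "colourable_on E L H" unfolding colourable_on_def
      using f g cross cross' A by (intro exI[of _ "\<lambda>x. if x \<in> A then f x else g x"]) auto
    thus False using H by simp
  qed
  have "H \<noteq> {}" using H(2) by (auto simp: colourable_on_def)
  then obtain v where v: "v \<in> H" by blast
  have extend: "card (\<Union>(L ` insert y A)) < card (\<Union>(L ` A)) + c"
    if "A \<subseteq> H" "x \<in> A" "y \<in> H - A" "L x \<inter> L y \<noteq> {}" for A x y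
  proof -
    have fy: "finite (L y)" "card (L y) = c" using that L H by auto
    have "\<Union>(L ` insert y A) = \<Union>(L ` A) \<union> (L y - L x)" using that by auto
    hence "card (\<Union>(L ` insert y A)) \<le> card (\<Union>(L ` A)) + card (L y - L x)"
      using card_Un_le by metis
    moreover have "card (L y - L x) < card (L y)"
      using that fy by (intro psubset_card_mono) auto
    ultimately show ?thesis using fy by simp
  qed
  \<comment> \<open>Exploration from \<open>v\<close> along edges given by \<open>cut\<close>: each
    of the \<open>m\<close> added vertices reuses a colour, so \<open>m\<close> steps produce at
    least \<open>m\<close> repetitions and stay within distance \<open>m\<close>.\<close>
  have grow: "\<exists>A\<subseteq>H. card A = Suc m \<and> A \<subseteq> ball_of E m v \<and> v \<in> A \<and>
                card (\<Union>(L ` A)) + m \<le> c * card A" if "m < card H" for m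
    using that
  proof (induction m)
    case 0
    show ?case using v L H by (intro exI[of _ "{v}"]) auto
  next
    case (Suc m)
    then obtain A where A: "A \<subseteq> H" "card A = Suc m" "A \<subseteq> ball_of E m v" "v \<in> A"
      "card (\<Union>(L ` A)) + m \<le> c * card A" by (meson Suc_lessD)
    have "A \<subset> H" using A Suc.prems by auto
    then obtain x y where xy: "x \<in> A" "y \<in> H - A" "(x, y) \<in> E" "L x \<inter> L y \<noteq> {}"
      using cut[of A] A(4) by blast
    have fA: "finite A" using A finH finite_subset by blast
    have "insert y A \<subseteq> ball_of E (Suc m) v" using A(3) xy(1,3) unfolding ball_of_Suc by blast
    moreover have "card (insert y A) = Suc (Suc m)" using xy fA A by simp
    ultimately show ?case
      using extend[OF A(1) xy(1,2,4)] A(1,2,4,5) xy(2)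
      by (intro exI[of _ "insert y A"] conjI) (simp_all)
  qed
  \<comment> \<open>A larger \<open>H\<close> would admit \<open>c\<^sup>2 + 1\<close> exploration
    steps, one repetition more than \<open>sparse\<close> permits.\<close>
  have "card H \<le> Suc (c\<^sup>2)"
  proof (rule ccontr)
    assume "\<not> ?thesis"
    then obtain A where A: "A \<subseteq> H" "A \<subseteq> ball_of E (Suc (c\<^sup>2)) v" 
        "card (\<Union>(L ` A)) + Suc (c\<^sup>2) \<le> c * card A"
      using grow[of "Suc (c\<^sup>2)"] by (meson not_le_imp_less)
    have "A \<subseteq> V \<inter> ball_of E (Suc (c\<^sup>2)) v" using A(1,2) H(1) by blast
    moreover have "v \<in> V" using v H(1) by blast
    ultimately show False using sparse[of v A] A(3) by linarith
  qed
  hence le: "card H - 1 \<le> Suc (c\<^sup>2)" by simp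
  have "card H > 0" using v finH card_gt_0_iff by blast
  \<comment> \<open>After \<open>card H - 1\<close> steps the exploration has exhausted
    \<open>H\<close>, so all of \<open>H\<close> lies in a single ball and \<open>sparse\<close>
    applies to each of its subsets.\<close>
  then obtain A where A: "A \<subseteq> H" "card A = card H" "A \<subseteq> ball_of E (card H - 1) v"
    using grow[of "card H - 1"] by auto
  have "A = H" using card_subset_eq[OF finH A(1,2)] .
  hence Hball: "H \<subseteq> ball_of E (Suc (c\<^sup>2)) v"
    using A(3) ball_of_mono[OF le, of E v] by blast
  have sp: "c * card A \<le> card (\<Union>(L ` A)) + c\<^sup>2" if "A \<subseteq> H" for A
    using that Hball v H(1) by (intro sparse[of v]) blast+
  \<comment> \<open>An injective choice of colours would be a proper colouring of \<open>H\<close>,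
    so some \<open>X\<close> violates Hall's condition. Containing one list forces
    \<open>card X \<ge> c + 1\<close>; the bound on repetitions gives the reverse
    inequality.\<close>
  have "\<exists>X\<subseteq>H. card X = Suc c \<and> card (\<Union>(L ` X)) \<le> c"
  proof -
    have "\<not> (\<exists>f. inj_on f H \<and> (\<forall>x\<in>H. f x \<in> L x))"
    proof
      assume "\<exists>f. inj_on f H \<and> (\<forall>x\<in>H. f x \<in> L x)"
      hence "colourable_on E L H"
        unfolding colourable_on_def using E(2) unfolding inj_on_def irrefl_def by blast
      thus False using H by simp
    qed
    moreover have "\<exists>f. inj_on f H \<and> (\<forall>x\<in>H. f x \<in> L x)"
      if hall: "\<And>X. X \<subseteq> H \<Longrightarrow> card X \<le> card (\<Union>(L ` X))"
    proof -
      have "finite (L x)" if "x \<in> H" for x using that L H(1) by blast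
      then obtain f where "inj_on f H" "\<And>x. x \<in> H \<Longrightarrow> f x \<in> L x"
        using hall_marriage[of H L, OF finH _ hall] by blast
      thus ?thesis by blast
    qed
    ultimately obtain X where X: "X \<subseteq> H" "card (\<Union>(L ` X)) < card X"
      by (meson linorder_not_less)
    have finX: "finite X" using X finH finite_subset by blast
    have "X \<noteq> {}" using X(2) by auto
    then obtain x where x: "x \<in> X" by blast
    have "card (L x) \<le> card (\<Union>(L ` X))" using x finL[OF X(1)] by (intro card_mono) blast+
    moreover have "card (L x) = c" using x L X(1) H(1) by blast
    ultimately have ge: "Suc c \<le> card X" using X(2) by linarith
    show ?thesis
    \<comment> \<open>The upper bound on \<open>card X\<close> divides by \<open>c - 1\<close>; for
      singleton lists two equal ones are picked directly.\<close>
    proof (cases "c = 1")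
      case True
      have sing: "L x = {the_elem (L x)}" if "x \<in> X" for x
      proof -
        have "card (L x) = 1" using that L[of x] True X(1) H(1) by blast
        thus ?thesis by (metis card_1_singletonE the_elem_eq)
      qed
      hence "\<Union>(L ` X) = (\<lambda>x. the_elem (L x)) ` X" by blast
      hence "\<not> inj_on (\<lambda>x. the_elem (L x)) X" using X(2) card_image by fastforce
      then obtain x y where xy: "x \<in> X" "y \<in> X" "x \<noteq> y" "the_elem (L x) = the_elem (L y)"
        by (auto simp: inj_on_def)
      have "L x = L y" using sing[OF xy(1)] sing[OF xy(2)] xy(4) by simp
      moreover have "card (L x) = c" using xy(1) L X(1) H(1) by blast
      ultimately show ?thesis using X(1) True xy by (intro exI[of _ "{x, y}"]) auto
    next
      case False
      then obtain d where d: "c = Suc d" "d \<ge> 1" using c by (cases c) auto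
      \<comment> \<open>With \<open>d = c - 1\<close> this reads
        \<open>d * card X < (d + 1)\<^sup>2 = d * (d + 2) + 1\<close>, whence
        \<open>card X \<le> d + 2 = c + 1\<close>.\<close>
      have "c * card X < card X + c\<^sup>2" using sp[OF X(1)] X(2) by linarith
      hence "d * card X < d * (d + 2) + 1" using d by (simp add: power2_eq_square algebra_simps)
      hence "d * card X \<le> d * (d + 2)" by linarith
      hence "card X \<le> d + 2" using d(2) mult_le_cancel1[of d "card X" "d + 2"] by linarith
      hence "card X \<le> Suc c" using d(1) by simp
      thus ?thesis using ge X by (intro exI[of _ X] conjI) linarith+
    qed
  qed
  then obtain X where X: "X \<subseteq> H" "card X = Suc c" "card (\<Union>(L ` X)) \<le> c" by blast
  define A where "A = \<Union>(L ` X)"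
  have finA: "finite A" unfolding A_def by (rule finL[OF X(1)])
  have LA: "L x = A" if "x \<in> X" for x
  proof (rule card_seteq[OF finA])
    show "L x \<subseteq> A" using that by (auto simp: A_def)
    show "card A \<le> card (L x)" using X(3) that L[of x] X(1) H(1) by (auto simp: A_def)
  qed
  have "X \<noteq> {}" using X by auto
  then have cA: "card A = c" using LA L X(1) H(1) by (metis ex_in_conv subsetD)
  \<comment> \<open>If \<open>u\<close> and \<open>w\<close> were not adjacent, they could share a
    colour while the other members take the remaining \<open>c - 1\<close> colours. Then
    \<open>X\<close> would be colourable, hence a proper subset of \<open>H\<close>, and
    \<open>cut\<close> would supply a further vertex with a shared colour:
    \<open>c * (c + 2)\<close> list entries on fewer than \<open>2 * c\<close> colours, one
    repetition too many.\<close>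
  have "(u, w) \<in> E" if uw: "u \<in> X" "w \<in> X" "u \<noteq> w" for u w
  proof (rule ccontr)
    assume nE: "(u, w) \<notin> E"
    hence nE': "(w, u) \<notin> E" using E(1) by (meson symD)
    have finX: "finite X" using X(1) finH finite_subset by blast
    have "card (X - {u}) = card A" using card_Diff_singleton[OF uw(1)] X(2) cA by simp
    then obtain g where g: "bij_betw g (X - {u}) A"
      using finite_same_card_bij[OF finite_Diff[OF finX] finA] by blast
    have gA: "g x \<in> A" if "x \<in> X" "x \<noteq> u" for x using bij_betwE[OF g] that by simp
    have ginj: "g x \<noteq> g y" if "x \<in> X" "x \<noteq> u" "y \<in> X" "y \<noteq> u" "x \<noteq> y" for x y
      using inj_onD[OF bij_betw_imp_inj_on[OF g], of x y] that by auto
    have irr: "x \<noteq> y" if "(x, y) \<in> E" for x y using that E(2) by (auto simp: irrefl_def)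
    have "colourable_on E L X" unfolding colourable_on_def
    proof (intro exI[of _ "g(u := g w)"] conjI ballI impI)
      show "(g(u := g w)) x \<in> L x" if "x \<in> X" for x using gA uw LA that by auto
      show "(g(u := g w)) x \<noteq> (g(u := g w)) y" if "x \<in> X" "y \<in> X" "(x, y) \<in> E" for x y
        using that irr ginj uw nE nE' by (metis fun_upd_apply)
    qed
    hence "X \<subset> H" using X H by auto
    then obtain x y where xy: "x \<in> X" "y \<in> H - X" "L x \<inter> L y \<noteq> {}"
      using cut[of X] \<open>X \<noteq> {}\<close> by blast
    have "card (\<Union>(L ` insert y X)) < 2 * c"
      using extend[OF X(1) xy] X(3) by simp
    moreover have "c * card (insert y X) \<le> card (\<Union>(L ` insert y X)) + c\<^sup>2"
      using xy X by (intro sp) auto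
    moreover have "card (insert y X) = c + 2" using xy X finX by simp
    ultimately show False by (simp add: power2_eq_square algebra_simps)
  qed
  hence "X \<in> cliques E V (Suc c)" using X H by (auto simp: cliques_def)
  thus ?thesis using that LA by blast
qed

subsection \<open>Random lists\<close>

lemma abs_exp_minus_le:
  assumes "q \<ge> (0::real)"
  shows "\<bar>exp (- q) - (1 - q)\<bar> \<le> q\<^sup>2"
proof -
  have "1 + - q \<le> exp (- q)" by (rule exp_ge_add_one_self)
  moreover have "exp (- q) \<le> 1 - q + q\<^sup>2"
  proof -
    have "exp (- q) * (1 + q) \<le> exp (- q) * exp q"
      by (intro mult_left_mono) (auto simp: exp_ge_add_one_self)
    also have "\<dots> = 1" by (simp flip: exp_add)
    also have "1 \<le> (1 - q + q\<^sup>2) * (1 + q)"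
      using assms by (simp add: algebra_simps power2_eq_square)
    finally show ?thesis using assms by simp
  qed
  ultimately show ?thesis by simp
qed

text \<open>The events are added one at a time. Each addition multiplies the avoidance probability
  by \<open>1 - q\<close> up to \<open>d * \<delta> + d * q\<^sup>2\<close>, the price of the at
  most \<open>d\<close> dependent events; replacing \<open>1 - q\<close> by \<open>exp (- q)\<close>
  costs another \<open>q\<^sup>2\<close>. Earlier errors do not grow, since they are multiplied by
  \<open>exp (- q) \<le> 1\<close>.\<close>

lemma prob_none_near_exp:
  fixes p :: "'b pmf" and A :: "'i \<Rightarrow> 'b set" and N :: "'i \<Rightarrow> 'i set"
    and q \<delta> :: real and d :: nat
  assumes I: "finite I" and q: "\<And>i. i \<in> I \<Longrightarrow> measure_pmf.prob p (A i) = q"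
    and N: "\<And>i. i \<in> I \<Longrightarrow> finite (N i) \<and> card (N i) \<le> d"
    and near: "\<And>i j. i \<in> I \<Longrightarrow> j \<in> I \<Longrightarrow> j \<in> N i \<Longrightarrow> i \<noteq> j \<Longrightarrow>
                 measure_pmf.prob p (A i \<inter> A j) \<le> \<delta>"
    and far: "\<And>i J. i \<in> I \<Longrightarrow> J \<subseteq> I - N i - {i} \<Longrightarrow>
                 measure_pmf.prob p (A i \<inter> \<Union>(A ` J)) = q * measure_pmf.prob p (\<Union>(A ` J))"
    and nonneg: "q \<ge> 0" "\<delta> \<ge> 0"
  shows "\<bar>1 - measure_pmf.prob p (\<Union>(A ` I)) - exp (- (q * card I))\<bar>
           \<le> card I * (d * \<delta> + (d + 1) * q\<^sup>2)"
proof -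
  let ?P = "measure_pmf.prob p"
  define e where "e = d * \<delta> + (d + 1) * q\<^sup>2"
  have "\<bar>1 - ?P (\<Union>(A ` J)) - exp (- (q * card J))\<bar> \<le> card J * e" if "J \<subseteq> I" for J
    using finite_subset[OF that I] that
  proof (induction J rule: finite_induct)
    case empty
    then show ?case by simp
  next
    case (insert i J)
    hence i: "i \<in> I" and J: "J \<subseteq> I" by auto
    note Ni = N[OF i]
    define U where "U = \<Union>(A ` J)"
    \<comment> \<open>\<open>U1\<close> keeps only the earlier events independent of
      \<open>A i\<close>. Passing from \<open>U\<close> to \<open>U1\<close> changes the probability
      of the union by at most \<open>d * q\<close>, and that of \<open>A i\<close> minus the union
      by at most \<open>d * \<delta>\<close>.\<close>
    define U1 where "U1 = \<Union>(A ` (J - N i))"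
    define a where "a = 1 - ?P U"
    have fJ2: "finite (J \<inter> N i)" "card (J \<inter> N i) \<le> d"
      using Ni card_mono[of "N i" "J \<inter> N i"] by auto
    have U1: "U1 \<subseteq> U" by (auto simp: U_def U1_def)
    have P_union: "?P (\<Union>(A ` insert i J)) = ?P U + ?P (A i - U)"
      by (subst measure_pmf.finite_measure_Union[symmetric])
         (auto simp: U_def intro!: arg_cong[where f = ?P])
    have "?P U \<le> ?P (U1 \<union> (\<Union>j\<in>J \<inter> N i. A j))"
      by (intro measure_pmf.finite_measure_mono) (auto simp: U_def U1_def)
    also have "\<dots> \<le> ?P U1 + ?P (\<Union>j\<in>J \<inter> N i. A j)"
      by (rule measure_Un_le) auto
    also have "?P (\<Union>j\<in>J \<inter> N i. A j) \<le> (\<Sum>j\<in>J \<inter> N i. ?P (A j))"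
      using fJ2 by (intro measure_pmf.finite_measure_subadditive_finite) auto
    also have "\<dots> = card (J \<inter> N i) * q" using q J by (subst sum.cong[OF refl q]) auto
    also have "\<dots> \<le> d * q" using fJ2 nonneg by (intro mult_right_mono) auto
    finally have le1: "?P U \<le> ?P U1 + d * q" by simp
    have le2: "?P U1 \<le> ?P U" using U1 by (intro measure_pmf.finite_measure_mono) auto
    have "?P (A i - U1) = ?P (A i) - ?P (A i \<inter> U1)"
      by (rule measure_pmf.finite_measure_Diff') auto
    also have "\<dots> = q - q * ?P U1"
      unfolding U1_def using insert.hyps i J by (subst far) (auto simp: q)
    finally have eq: "?P (A i - U1) = q * (1 - ?P U1)" by (simp add: algebra_simps)
    have up: "?P (A i - U) \<le> ?P (A i - U1)"
      using U1 by (intro measure_pmf.finite_measure_mono) auto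
    have "?P (A i - U1) \<le> ?P ((A i - U) \<union> (\<Union>j\<in>J \<inter> N i. A i \<inter> A j))"
      by (intro measure_pmf.finite_measure_mono) (auto simp: U_def U1_def)
    also have "\<dots> \<le> ?P (A i - U) + ?P (\<Union>j\<in>J \<inter> N i. A i \<inter> A j)"
      by (rule measure_Un_le) auto
    also have "?P (\<Union>j\<in>J \<inter> N i. A i \<inter> A j) \<le> (\<Sum>j\<in>J \<inter> N i. ?P (A i \<inter> A j))"
      using fJ2 by (intro measure_pmf.finite_measure_subadditive_finite) auto
    also have "\<dots> \<le> (\<Sum>j\<in>J \<inter> N i. \<delta>)"
      using insert.hyps i J by (intro sum_mono near) auto
    also have "\<dots> \<le> d * \<delta>" using fJ2 nonneg by (simp add: mult_right_mono)
    finally have low: "?P (A i - U1) \<le> ?P (A i - U) + d * \<delta>" by simp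
    have "q * a \<le> q * (1 - ?P U1)" "q * (1 - ?P U1) \<le> q * (a + d * q)"
      using le1 le2 nonneg by (auto intro!: mult_left_mono simp: a_def)
    hence "\<bar>a - ?P (A i - U) - (1 - q) * a\<bar> \<le> d * \<delta> + d * q\<^sup>2"
      using up low nonneg unfolding eq by (auto simp: algebra_simps power2_eq_square abs_le_iff add_increasing add_increasing2)
    moreover have "\<bar>(1 - q) * a - exp (- q) * a\<bar> \<le> q\<^sup>2"
    proof -
      have "\<bar>(1 - q) * a - exp (- q) * a\<bar> = \<bar>exp (- q) - (1 - q)\<bar> * \<bar>a\<bar>"
        by (simp flip: abs_mult left_diff_distrib) (simp add: abs_mult abs_minus_commute)
      also have "\<dots> \<le> q\<^sup>2 * 1"
        using abs_exp_minus_le[OF nonneg(1)] by (intro mult_mono) (auto simp: a_def)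
      finally show ?thesis by simp
    qed
    moreover have "\<bar>exp (- q) * a - exp (- (q * card (insert i J)))\<bar> \<le> card J * e"
    proof -
      have "exp (- (q * card (insert i J))) = exp (- q) * exp (- (q * card J))"
        using insert.hyps by (simp flip: exp_add) (simp add: algebra_simps)
      hence "\<bar>exp (- q) * a - exp (- (q * card (insert i J)))\<bar>
          = exp (- q) * \<bar>a - exp (- (q * card J))\<bar>"
        by (simp add: abs_mult flip: right_diff_distrib)
      also have "\<dots> \<le> 1 * \<bar>a - exp (- (q * card J))\<bar>"
        using nonneg by (intro mult_right_mono) auto
      also have "\<dots> \<le> card J * e" using insert.IH[OF J] by (simp add: a_def U_def)
      finally show ?thesis .
    qed
    ultimately have "\<bar>a - ?P (A i - U) - exp (- (q * card (insert i J)))\<bar>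
       \<le> d * \<delta> + d * q\<^sup>2 + q\<^sup>2 + card J * e" by linarith
    also have "\<dots> = card (insert i J) * e" using insert.hyps by (simp add: e_def algebra_simps)
    finally show ?case unfolding P_union by (simp add: a_def algebra_simps)
  qed
  from this[of I] show ?thesis by (simp add: e_def)
qed

text \<open>The product distribution factors into its coordinates in \<open>X\<close> and the
  others; \<open>P\<close> sees only the first factor and \<open>Q\<close> only the second.\<close>

lemma prob_Pi_pmf_indep:
  assumes V: "finite V" and P: "\<And>f g. (\<And>x. x \<in> X \<Longrightarrow> f x = g x) \<Longrightarrow> P f = P g"
    and Q: "\<And>f g. (\<And>x. x \<notin> X \<Longrightarrow> f x = g x) \<Longrightarrow> Q f = Q g"
  shows "measure_pmf.prob (Pi_pmf V d p) {f. P f \<and> Q f} =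
         measure_pmf.prob (Pi_pmf V d p) {f. P f} * measure_pmf.prob (Pi_pmf V d p) {f. Q f}"
proof -
  let ?A = "Pi_pmf (V \<inter> X) d p" and ?B = "Pi_pmf (V - X) d p"
  let ?h = "\<lambda>(f, g) x. if x \<in> V \<inter> X then f x else g x"
  have decomp: "Pi_pmf V d p = map_pmf ?h (pair_pmf ?A ?B)"
    using Pi_pmf_union[of "V \<inter> X" "V - X" d p] V by (auto simp: Int_Diff_Un)
  \<comment> \<open>\<open>X\<close> may reach outside \<open>V\<close>, where the glued function
    takes its value from \<open>g\<close>. There both \<open>f\<close> and \<open>g\<close> have the
    default value \<open>d\<close> on the supports, so \<open>P\<close> still sees the same
    values.\<close>
  have supp: "f x = d" if "f \<in> set_pmf ?A" "x \<notin> V \<inter> X" for f x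
    using set_Pi_pmf_subset[of "V \<inter> X" d p] V that by auto
  have supp': "f x = d" if "f \<in> set_pmf ?B" "x \<notin> V - X" for f x
    using set_Pi_pmf_subset[of "V - X" d p] V that by auto
  have val: "P (?h (f, g)) = P f" "Q (?h (f, g)) = Q g"
    if "f \<in> set_pmf ?A" "g \<in> set_pmf ?B" for f g
    using supp[OF that(1)] supp'[OF that(2)] by (auto intro!: P Q)
  have pair: "measure_pmf.prob (Pi_pmf V d p) {f. R f} =
      measure_pmf.prob ?A {f. R1 f} * measure_pmf.prob ?B {f. R2 f}"
    if "\<And>f g. f \<in> set_pmf ?A \<Longrightarrow> g \<in> set_pmf ?B \<Longrightarrow> R (?h (f, g)) = (R1 f \<and> R2 g)" for R R1 R2
  proof -
    have "measure_pmf.prob (Pi_pmf V d p) {f. R f} =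
        measure_pmf.prob (pair_pmf ?A ?B) (?h -` {f. R f})"
      unfolding decomp by (rule measure_map_pmf)
    also have "\<dots> = measure_pmf.prob (pair_pmf ?A ?B) (?h -` {f. R f} \<inter> set_pmf (pair_pmf ?A ?B))"
      by (rule measure_Int_set_pmf[symmetric])
    also have "?h -` {f. R f} \<inter> set_pmf (pair_pmf ?A ?B) =
        ({f. R1 f} \<inter> set_pmf ?A) \<times> ({f. R2 f} \<inter> set_pmf ?B)"
      using that by auto
    also have "measure_pmf.prob (pair_pmf ?A ?B) \<dots> =
        measure_pmf.prob ?A ({f. R1 f} \<inter> set_pmf ?A) * measure_pmf.prob ?B ({f. R2 f} \<inter> set_pmf ?B)"
      by (rule measure_pmf_prob_product) (auto intro: countable_Int2)
    finally show ?thesis by (simp add: measure_Int_set_pmf)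
  qed
  have "measure_pmf.prob (Pi_pmf V d p) {f. P f \<and> Q f} =
      measure_pmf.prob ?A {f. P f} * measure_pmf.prob ?B {f. Q f}"
    using val by (intro pair) blast
  moreover have "measure_pmf.prob (Pi_pmf V d p) {f. P f} =
      measure_pmf.prob ?A {f. P f} * measure_pmf.prob ?B {f. True}"
    using val by (intro pair) blast
  moreover have "measure_pmf.prob (Pi_pmf V d p) {f. Q f} =
      measure_pmf.prob ?A {f. True} * measure_pmf.prob ?B {f. Q f}"
    using val by (intro pair) blast
  ultimately show ?thesis by simp
qed

lemma prob_Pi_pmf_Ball:
  assumes "finite V" "X \<subseteq> V"
  shows "measure_pmf.prob (Pi_pmf V d p) {f. \<forall>x\<in>X. f x \<in> K x} =
         (\<Prod>x\<in>X. measure_pmf.prob (p x) (K x))"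
proof -
  have "{f. \<forall>x\<in>X. f x \<in> K x} = Pi V (\<lambda>x. if x \<in> X then K x else UNIV)"
    using assms(2) by (auto simp: Pi_def)
  hence "measure_pmf.prob (Pi_pmf V d p) {f. \<forall>x\<in>X. f x \<in> K x} =
     (\<Prod>x\<in>V. measure_pmf.prob (p x) (if x \<in> X then K x else UNIV))"
    using assms(1) by (simp add: measure_Pi_pmf_Pi)
  also have "\<dots> = (\<Prod>x\<in>X. measure_pmf.prob (p x) (K x))"
    using assms by (intro prod.mono_neutral_cong_right) (auto simp: measure_pmf.prob_space)
  finally show ?thesis .
qed

text \<open>There are \<open>card K\<close> possible common values, each taken on all of
  \<open>X\<close> with probability \<open>1 / card K ^ (m + 1)\<close>.\<close>

lemma prob_Pi_pmf_of_set_constant_on: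
  assumes V: "finite V" and X: "X \<subseteq> V" "card X = Suc m" and K: "finite K" "K \<noteq> {}"
  shows "measure_pmf.prob (Pi_pmf V d (\<lambda>_. pmf_of_set K)) {f. \<forall>x\<in>X. \<forall>y\<in>X. f x = f y} =
         1 / real (card K) ^ m"
proof -
  let ?M = "Pi_pmf V d (\<lambda>_. pmf_of_set K)"
  have "X \<noteq> {}" using X by auto
  then obtain x0 where x0: "x0 \<in> X" by blast
  have single: "measure_pmf.prob ?M {f. \<forall>x\<in>X. f x \<in> {a}} = 1 / real (card K) ^ Suc m"
    if "a \<in> K" for a
    using X V K that
    by (subst prob_Pi_pmf_Ball) (simp_all add: measure_pmf_of_set power_divide)
  have "AE f in ?M. (f \<in> {f. \<forall>x\<in>X. \<forall>y\<in>X. f x = f y}) = (f \<in> (\<Union>a\<in>K. {f. \<forall>x\<in>X. f x \<in> {a}}))"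
  proof (intro AE_pmfI)
    fix f assume "f \<in> set_pmf ?M"
    hence "f x \<in> K" if "x \<in> X" for x
      using that V K X by (auto simp: set_Pi_pmf PiE_dflt_def)
    thus "(f \<in> {f. \<forall>x\<in>X. \<forall>y\<in>X. f x = f y}) = (f \<in> (\<Union>a\<in>K. {f. \<forall>x\<in>X. f x \<in> {a}}))"
      using x0 by auto
  qed
  hence "measure_pmf.prob ?M {f. \<forall>x\<in>X. \<forall>y\<in>X. f x = f y} =
      measure_pmf.prob ?M (\<Union>a\<in>K. {f. \<forall>x\<in>X. f x \<in> {a}})"
    by (intro measure_pmf.finite_measure_eq_AE) auto
  also have "\<dots> = (\<Sum>a\<in>K. measure_pmf.prob ?M {f. \<forall>x\<in>X. f x \<in> {a}})"
    using K x0 by (intro measure_pmf.finite_measure_finite_Union)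
      (auto simp: disjoint_family_on_def)
  also have "\<dots> = (\<Sum>a\<in>K. 1 / real (card K) ^ Suc m)" using single by (intro sum.cong) auto
  also have "\<dots> = 1 / real (card K) ^ m" using K by simp
  finally show ?thesis .
qed

section \<open>Repeated colours in random lists\<close>

definition nsubsets_of :: "'a set \<Rightarrow> nat \<Rightarrow> 'a set set" where
  "nsubsets_of S c = {A. A \<subseteq> S \<and> card A = c}"

lemma finite_nsubsets_of [simp]: "finite S \<Longrightarrow> finite (nsubsets_of S c)"
  by (simp add: nsubsets_of_def)

lemma card_nsubsets_of: "finite S \<Longrightarrow> card (nsubsets_of S c) = card S choose c"
  by (simp add: nsubsets_of_def n_subsets)

lemma nsubsets_of_nonempty: "finite S \<Longrightarrow> c \<le> card S \<Longrightarrow> nsubsets_of S c \<noteq> {}"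
  using obtain_subset_with_card_n[of c S] by (fastforce simp: nsubsets_of_def)

text \<open>Union bound over the \<open>u\<close>-sets of colours that may contain every list on
  \<open>X\<close>; a fixed one contains a given list with probability
  \<open>(u choose c) / (card S choose c)\<close>.\<close>

lemma prob_card_Union_le:
  assumes V: "finite V" and X: "X \<subseteq> V" and S: "finite S" "c \<le> card S" "u \<le> card S"
  shows "measure_pmf.prob (Pi_pmf V d (\<lambda>_. pmf_of_set (nsubsets_of S c)))
            {L. card (\<Union>(L ` X)) \<le> u}
         \<le> real (card S choose u) * (real (u choose c) / real (card S choose c)) ^ card X"
proof -
  let ?K = "nsubsets_of S c"
  let ?M = "Pi_pmf V d (\<lambda>_. pmf_of_set ?K)"
  have K: "finite ?K" "?K \<noteq> {}" using S nsubsets_of_nonempty by auto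
  have "measure_pmf.prob ?M {L. card (\<Union>(L ` X)) \<le> u} =
      measure_pmf.prob ?M ({L. card (\<Union>(L ` X)) \<le> u} \<inter> set_pmf ?M)"
    by (simp add: measure_Int_set_pmf)
  also have "\<dots> \<le> measure_pmf.prob ?M (\<Union>U\<in>nsubsets_of S u. {L. \<forall>x\<in>X. L x \<in> nsubsets_of U c})"
  proof (intro measure_pmf.finite_measure_mono subsetI)
    fix L assume "L \<in> {L. card (\<Union>(L ` X)) \<le> u} \<inter> set_pmf ?M"
    hence le: "card (\<Union>(L ` X)) \<le> u" and LK: "\<And>x. x \<in> X \<Longrightarrow> L x \<in> ?K"
      using V K X by (auto simp: set_Pi_pmf PiE_dflt_def)
    have "\<Union>(L ` X) \<subseteq> S" using LK by (auto simp: nsubsets_of_def)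
    then obtain U where "\<Union>(L ` X) \<subseteq> U" "U \<subseteq> S" "card U = u"
      using exists_subset_between[OF le S(3) _ S(1)] by blast
    moreover from this have "L x \<in> nsubsets_of U c" if "x \<in> X" for x
      using LK[OF that] that by (auto simp: nsubsets_of_def)
    ultimately show "L \<in> (\<Union>U\<in>nsubsets_of S u. {L. \<forall>x\<in>X. L x \<in> nsubsets_of U c})"
      by (auto simp: nsubsets_of_def)
  qed auto
  also have "\<dots> \<le> (\<Sum>U\<in>nsubsets_of S u. measure_pmf.prob ?M {L. \<forall>x\<in>X. L x \<in> nsubsets_of U c})"
    using S by (intro measure_pmf.finite_measure_subadditive_finite) auto
  also have "\<dots> = (\<Sum>U\<in>nsubsets_of S u. (real (u choose c) / real (card S choose c)) ^ card X)"
  proof (rule sum.cong[OF refl])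
    fix U assume U: "U \<in> nsubsets_of S u"
    hence "finite U" "card U = u" using S finite_subset by (auto simp: nsubsets_of_def)
    moreover have "?K \<inter> nsubsets_of U c = nsubsets_of U c"
      using U by (auto simp: nsubsets_of_def)
    ultimately show "measure_pmf.prob ?M {L. \<forall>x\<in>X. L x \<in> nsubsets_of U c} =
        (real (u choose c) / real (card S choose c)) ^ card X"
      using V X K S(1) by (subst prob_Pi_pmf_Ball) (auto simp: measure_pmf_of_set card_nsubsets_of)
  qed
  also have "\<dots> = real (card S choose u) * (real (u choose c) / real (card S choose c)) ^ card X"
    using S by (simp add: card_nsubsets_of)
  finally show ?thesis .
qed

text \<open>With \<open>s = card S\<close> and \<open>u = c * card X - j\<close>, the union bound
  has order \<open>s ^ u / s ^ (c * card X) = 1 / s ^ j\<close>: every repetition costs a factor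
  \<open>s\<close>. The constant depends on \<open>c\<close> and \<open>m\<close> only.\<close>

lemma prob_card_Union_deficient_le:
  assumes V: "finite V" and X: "X \<subseteq> V" "card X \<le> m"
    and S: "finite S" "c \<le> card S" "c * m \<le> card S" and c: "c \<ge> 1" and m: "m \<ge> 1"
  shows "measure_pmf.prob (Pi_pmf V d (\<lambda>_. pmf_of_set (nsubsets_of S c)))
            {L. card (\<Union>(L ` X)) + j \<le> c * card X}
         \<le> real (c * (c * m)) ^ (c * m) / real (card S) ^ j"
    (is "measure_pmf.prob ?M ?D \<le> _")
proof (cases "j \<le> c * card X")
  \<comment> \<open>The event is empty here; in the other case the natural-number subtraction
    defining \<open>u\<close> is exact.\<close>
  case False
  hence "?D = {}" by auto
  thus ?thesis by (simp only: measure_empty) simp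
next
  case True
  define u where "u = c * card X - j"
  define s where "s = real (card S)"
  have s: "s > 0" using S c by (auto simp: s_def)
  have "c * card X \<le> c * m" using X by simp
  hence u: "u \<le> card S" "u \<le> c * m" using S unfolding u_def by linarith+
  have b1: "real (card S choose u) \<le> s ^ u"
    unfolding s_def using binomial_le_pow[OF u(1)] by (simp flip: of_nat_power)
  have b2: "real (u choose c) \<le> real (c * m) ^ c"
  proof (cases "c \<le> u")
    case True
    hence "u choose c \<le> u ^ c" by (rule binomial_le_pow)
    also have "\<dots> \<le> (c * m) ^ c" using u by (intro power_mono) auto
    finally have "real (u choose c) \<le> real ((c * m) ^ c)" by (simp only: of_nat_le_iff)
    thus ?thesis by (simp only: of_nat_power)
  qed (simp add: binomial_eq_0)
  have b3: "(s / c) ^ c \<le> real (card S choose c)"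
    unfolding s_def by (rule binomial_ge_n_over_k_pow_k[OF S(2)])
  have "real (u choose c) / real (card S choose c) \<le> real (c * m) ^ c / (s / c) ^ c"
    using b2 b3 s c by (intro frac_le) auto
  also have "\<dots> = (real (c * (c * m)) / s) ^ c"
    using s c by (simp flip: power_divide) (simp add: field_simps)
  finally have b4: "real (u choose c) / real (card S choose c) \<le> (real (c * (c * m)) / s) ^ c" .
  have "?D = {L. card (\<Union>(L ` X)) \<le> u}"
    using True by (auto simp: u_def)
  hence "measure_pmf.prob ?M ?D
      \<le> real (card S choose u) * (real (u choose c) / real (card S choose c)) ^ card X"
    using prob_card_Union_le[OF V X(1) S(1,2) u(1)] by simp
  also have "\<dots> \<le> s ^ u * ((real (c * (c * m)) / s) ^ c) ^ card X"
    using b1 b4 s by (intro mult_mono power_mono) auto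
  also have "\<dots> = real (c * (c * m)) ^ (c * card X) * (s ^ u / s ^ (c * card X))"
    by (simp add: power_divide flip: power_mult)
  also have "s ^ (c * card X) = s ^ u * s ^ j" using True by (simp add: u_def flip: power_add)
  also have "real (c * (c * m)) ^ (c * card X) \<le> real (c * (c * m)) ^ (c * m)"
    using c m X by (intro power_increasing) (auto simp del: of_nat_mult)
  finally show ?thesis using s by (simp add: s_def divide_right_mono)
qed

subsection \<open>Graphs of bounded degree\<close>

lemma card_ball_of_le:
  assumes E: "E \<subseteq> V \<times> V" "finite V" and deg: "\<And>v. v \<in> V \<Longrightarrow> card (E `` {v}) \<le> D"
    and v: "v \<in> V"
  shows "ball_of E r v \<subseteq> V \<and> card (ball_of E r v) \<le> (D + 1) ^ r"
proof (induction r)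
  case 0
  show ?case using v by simp
next
  case (Suc r)
  let ?B = "ball_of E r v"
  have fin: "finite ?B" using Suc E(2) finite_subset by blast
  have eq: "ball_of E (Suc r) v = (\<Union>w\<in>?B. insert w (E `` {w}))"
    unfolding ball_of_Suc by blast
  have "card (ball_of E (Suc r) v) \<le> (\<Sum>w\<in>?B. card (insert w (E `` {w})))"
    unfolding eq by (rule card_UN_le[OF fin])
  also have "\<dots> \<le> (\<Sum>w\<in>?B. D + 1)"
  proof (rule sum_mono)
    fix w assume "w \<in> ?B"
    hence "card (E `` {w}) \<le> D" using Suc deg by blast
    thus "card (insert w (E `` {w})) \<le> D + 1"
      using card_insert_le_m1[of "D + 1" "E `` {w}" w] by simp
  qed
  also have "\<dots> \<le> (D + 1) ^ r * (D + 1)" using Suc by (simp add: mult_right_mono del: mult_Suc_right)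
  finally have "card (ball_of E (Suc r) v) \<le> (D + 1) ^ Suc r" by (simp only: power_Suc2)
  moreover have "ball_of E (Suc r) v \<subseteq> V" using Suc E(1) unfolding eq by blast
  ultimately show ?case by blast
qed

lemma finite_cliques: "finite V \<Longrightarrow> finite (cliques E V m)"
  by (simp add: cliques_def)

text \<open>A clique through \<open>x\<close> is a subset of the closed neighbourhood of
  \<open>x\<close>, which has at most \<open>D + 1\<close> elements.\<close>

lemma card_cliques_meeting_le:
  assumes V: "finite V" and E: "E \<subseteq> V \<times> V" and deg: "\<And>v. v \<in> V \<Longrightarrow> card (E `` {v}) \<le> D"
    and X: "X \<in> cliques E V m"
  shows "card {Y \<in> cliques E V m. Y \<inter> X \<noteq> {}} \<le> m * 2 ^ (D + 1)"
proof -
  have XV: "X \<subseteq> V" "card X = m" using X by (auto simp: cliques_def)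
  have fX: "finite X" using XV V finite_subset by blast
  have fE: "finite (E `` {x})" for x using E V by (auto intro: finite_subset[of _ V])
  have "{Y \<in> cliques E V m. Y \<inter> X \<noteq> {}} \<subseteq> (\<Union>x\<in>X. Pow (insert x (E `` {x})))"
    by (fastforce simp: cliques_def)
  hence "card {Y \<in> cliques E V m. Y \<inter> X \<noteq> {}} \<le> card (\<Union>x\<in>X. Pow (insert x (E `` {x})))"
    using fX fE by (intro card_mono) auto
  also have "\<dots> \<le> (\<Sum>x\<in>X. card (Pow (insert x (E `` {x}))))"
    by (rule card_UN_le[OF fX])
  also have "\<dots> \<le> (\<Sum>x\<in>X. 2 ^ (D + 1))"
  proof (rule sum_mono)
    fix x assume "x \<in> X"
    hence "card (E `` {x}) \<le> D" using deg XV by blast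
    hence "card (insert x (E `` {x})) \<le> D + 1"
      using card_insert_le_m1[of "D + 1" "E `` {x}" x] by simp
    thus "card (Pow (insert x (E `` {x}))) \<le> 2 ^ (D + 1)"
      using fE power_increasing[of "card (insert x (E `` {x}))" "D + 1" "2 :: nat"]
      by (subst card_Pow) simp_all
  qed
  also have "\<dots> = m * 2 ^ (D + 1)" using XV by simp
  finally show ?thesis .
qed

text \<open>An instance of \<open>prob_none_near_exp\<close>: the events are the constant cliques,
  with \<open>q = 1 / b ^ c\<close>, \<open>\<delta> = 1 / b ^ (c + 1)\<close>, and the cliques
  meeting \<open>X\<close> as its dependency neighbourhood.\<close>

lemma prob_no_constant_clique:
  fixes V :: "'v set" and S :: "'a set" and d :: nat
  assumes V: "finite V" and E: "E \<subseteq> V \<times> V" and deg: "\<And>v. v \<in> V \<Longrightarrow> card (E `` {v}) \<le> D"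
    and S: "finite S" "c \<le> card S"
  defines "M \<equiv> Pi_pmf V {} (\<lambda>_. pmf_of_set (nsubsets_of S c))"
    and "b \<equiv> real (card S choose c)" and "N \<equiv> card (cliques E V (Suc c))"
    and "d \<equiv> Suc c * 2 ^ (D + 1)"
  shows "\<bar>1 - measure_pmf.prob M (\<Union>X\<in>cliques E V (Suc c). {L. \<forall>x\<in>X. \<forall>y\<in>X. L x = L y})
            - exp (- (N / b ^ c))\<bar> \<le> N * (d / b ^ Suc c + (d + 1) * (1 / b ^ c)\<^sup>2)"
proof -
  let ?K = "nsubsets_of S c" and ?C = "cliques E V (Suc c)"
  let ?A = "\<lambda>X. {L :: 'v \<Rightarrow> 'a set. \<forall>x\<in>X. \<forall>y\<in>X. L x = L y}"
  have K: "finite ?K" "?K \<noteq> {}" "real (card ?K) = b"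
    using S nsubsets_of_nonempty by (auto simp: card_nsubsets_of b_def)
  have C: "X \<subseteq> V" "card X = Suc c" "finite X" if "X \<in> ?C" for X
    using that V finite_subset by (auto simp: cliques_def)
  have "\<bar>1 - measure_pmf.prob M (\<Union>(?A ` ?C)) - exp (- (1 / b ^ c * card ?C))\<bar>
      \<le> card ?C * (d * (1 / b ^ Suc c) + (d + 1) * (1 / b ^ c)\<^sup>2)"
  proof (rule prob_none_near_exp[where N = "\<lambda>X. {Y \<in> ?C. Y \<inter> X \<noteq> {}}"])
    show "finite ?C" by (rule finite_cliques[OF V])
  next
    fix X assume X: "X \<in> ?C"
    show "measure_pmf.prob M (?A X) = 1 / b ^ c"
      unfolding M_def using prob_Pi_pmf_of_set_constant_on[OF V C(1,2)[OF X] K(1,2)] K(3) by simp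
    show "finite {Y \<in> ?C. Y \<inter> X \<noteq> {}} \<and> card {Y \<in> ?C. Y \<inter> X \<noteq> {}} \<le> d"
      using card_cliques_meeting_le[OF V E deg X] finite_cliques[OF V] by (simp add: d_def)
  next
    fix X Y assume XY: "X \<in> ?C" "Y \<in> ?C" "Y \<in> {Y \<in> ?C. Y \<inter> X \<noteq> {}}" "X \<noteq> Y"
    \<comment> \<open>Distinct cliques of equal size differ by some \<open>y\<close>. As they meet,
      their constant values agree, so at least the \<open>c + 2\<close> vertices of
      \<open>insert y X\<close> carry the same list.\<close>
    have "\<not> Y \<subseteq> X" using XY C[OF XY(1)] C[OF XY(2)] card_subset_eq[of X Y] by auto
    then obtain y where y: "y \<in> Y" "y \<notin> X" by blast
    have Z: "insert y X \<subseteq> V" "card (insert y X) = Suc (Suc c)"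
      using y C[OF XY(1)] C[OF XY(2)] by auto
    obtain w where w: "w \<in> Y" "w \<in> X" using XY(3) by blast
    have "?A X \<inter> ?A Y \<subseteq> ?A (insert y X)"
    proof
      fix L assume L: "L \<in> ?A X \<inter> ?A Y"
      have "L x = L w" if "x \<in> insert y X" for x using that L w y(1) by blast
      thus "L \<in> ?A (insert y X)" by simp
    qed
    hence "measure_pmf.prob M (?A X \<inter> ?A Y) \<le> measure_pmf.prob M (?A (insert y X))"
      by (intro measure_pmf.finite_measure_mono) auto
    also have "\<dots> = 1 / b ^ Suc c"
      unfolding M_def using prob_Pi_pmf_of_set_constant_on[OF V Z K(1,2)] K(3) by simp
    finally show "measure_pmf.prob M (?A X \<inter> ?A Y) \<le> 1 / b ^ Suc c" .
  next
    fix X J assume X: "X \<in> ?C" and J: "J \<subseteq> ?C - {Y \<in> ?C. Y \<inter> X \<noteq> {}} - {X}"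
    hence disj: "Y \<inter> X = {}" if "Y \<in> J" for Y using that by blast
    have "measure_pmf.prob M {L. L \<in> ?A X \<and> L \<in> \<Union>(?A ` J)} =
        measure_pmf.prob M {L. L \<in> ?A X} * measure_pmf.prob M {L. L \<in> \<Union>(?A ` J)}"
      unfolding M_def
    proof (rule prob_Pi_pmf_indep[where X = X, OF V])
      show "(L \<in> ?A X) = (L' \<in> ?A X)" if "\<And>x. x \<in> X \<Longrightarrow> L x = L' x" for L L'
        using that by simp
      show "(L \<in> \<Union>(?A ` J)) = (L' \<in> \<Union>(?A ` J))" if eq: "\<And>x. x \<notin> X \<Longrightarrow> L x = L' x" for L L'
      proof -
        have "L x = L' x" if "Y \<in> J" "x \<in> Y" for x Y using disj[OF that(1)] that(2) eq by blast
        thus ?thesis by simp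
      qed
    qed
    moreover have "measure_pmf.prob M (?A X) = 1 / b ^ c"
      unfolding M_def using prob_Pi_pmf_of_set_constant_on[OF V C(1,2)[OF X] K(1,2)] K(3) by simp
    ultimately show "measure_pmf.prob M (?A X \<inter> \<Union>(?A ` J)) =
        1 / b ^ c * measure_pmf.prob M (\<Union>(?A ` J))"
      by (simp only: Int_def[symmetric] Collect_mem_eq)
  qed (auto simp: b_def)
  thus ?thesis by (simp add: N_def add.commute)
qed

text \<open>A squeeze: colourability excludes constant cliques, and their absence implies
  colourability unless some ball of radius \<open>c\<^sup>2 + 1\<close> has more than
  \<open>c\<^sup>2\<close> repetitions. The last error term sums the probabilities of such
  balls.\<close>

lemma prob_colourable_on_near_exp:
  fixes V :: "'v set" and S :: "'a set" and d :: nat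
  assumes V: "finite V" and E: "E \<subseteq> V \<times> V" "sym E" "irrefl E"
    and deg: "\<And>v. v \<in> V \<Longrightarrow> card (E `` {v}) \<le> D"
    and c: "c \<ge> 1" and S: "finite S" "c * (D + 1) ^ Suc (c\<^sup>2) \<le> card S"
  defines "M \<equiv> Pi_pmf V {} (\<lambda>_. pmf_of_set (nsubsets_of S c))"
    and "b \<equiv> real (card S choose c)" and "N \<equiv> card (cliques E V (Suc c))"
    and "d \<equiv> Suc c * 2 ^ (D + 1)" and "m \<equiv> (D + 1) ^ Suc (c\<^sup>2)"
  shows "\<bar>measure_pmf.prob M {L. colourable_on E L V} - exp (- (N / b ^ c))\<bar>
     \<le> N * (d / b ^ Suc c + (d + 1) * (1 / b ^ c)\<^sup>2)
        + card V * (real (c * (c * m)) ^ (c * m) / real (card S) ^ Suc (c\<^sup>2))"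
proof -
  let ?K = "nsubsets_of S c" and ?C = "cliques E V (Suc c)" and ?P = "measure_pmf.prob M"
  let ?A = "\<lambda>X. {L :: 'v \<Rightarrow> 'a set. \<forall>x\<in>X. \<forall>y\<in>X. L x = L y}"
  let ?B = "\<lambda>v. ball_of E (Suc (c\<^sup>2)) v"
  let ?F = "\<lambda>v. {L :: 'v \<Rightarrow> 'a set. card (\<Union>(L ` ?B v)) + Suc (c\<^sup>2) \<le> c * card (?B v)}"
  let ?G = "{L :: 'v \<Rightarrow> 'a set. colourable_on E L V}"
  have m1: "m \<ge> 1" unfolding m_def by (rule one_le_power) simp
  have "c * 1 \<le> c * m" using m1 by (intro mult_left_mono) auto
  moreover have "c * m \<le> card S" using S(2) unfolding m_def .
  ultimately have S': "c \<le> card S" "c * m \<le> card S" by linarith+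
  have K: "finite ?K" "?K \<noteq> {}" using S S' nsubsets_of_nonempty by auto
  have ball: "ball_of E r v \<subseteq> V \<and> card (ball_of E r v) \<le> (D + 1) ^ r" if "v \<in> V" for r v
    by (rule card_ball_of_le[OF E(1) V deg that])
  have supp: "finite (L x) \<and> card (L x) = c" if "L \<in> set_pmf M" "x \<in> V" for L x
  proof -
    have "L x \<in> ?K" using that V K by (auto simp: M_def set_Pi_pmf PiE_dflt_def)
    thus ?thesis using S(1) finite_subset by (auto simp: nsubsets_of_def)
  qed
  \<comment> \<open>Lists have size \<open>c\<close> only almost surely, hence the restriction to
    the support.\<close>
  have "?P ?G = ?P (?G \<inter> set_pmf M)" by (simp add: measure_Int_set_pmf)
  also have "\<dots> \<le> ?P (- \<Union>(?A ` ?C))"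
  proof (intro measure_pmf.finite_measure_mono subsetI)
    fix L assume L: "L \<in> ?G \<inter> set_pmf M"
    have False if X: "X \<in> ?C" and cst: "\<forall>x\<in>X. \<forall>y\<in>X. L x = L y" for X
    proof -
      have "X \<noteq> {}" "X \<subseteq> V" using X by (auto simp: cliques_def)
      then obtain x where x: "x \<in> X" "x \<in> V" by blast
      have "\<not> colourable_on E L V"
        using clique_not_colourable[OF X, of L "L x"] cst x supp[of L x] L by blast
      thus False using L by simp
    qed
    thus "L \<in> - \<Union>(?A ` ?C)" by blast
  qed auto
  finally have upper: "?P ?G \<le> ?P (- \<Union>(?A ` ?C))" .
  have "?P (- \<Union>(?A ` ?C)) = ?P (- \<Union>(?A ` ?C) \<inter> set_pmf M)" by (simp add: measure_Int_set_pmf)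
  also have "\<dots> \<le> ?P (?G \<union> (\<Union>v\<in>V. ?F v))"
  proof (intro measure_pmf.finite_measure_mono subsetI)
    fix L assume L: "L \<in> - \<Union>(?A ` ?C) \<inter> set_pmf M"
    show "L \<in> ?G \<union> (\<Union>v\<in>V. ?F v)"
    proof (rule ccontr)
      assume "L \<notin> ?G \<union> (\<Union>v\<in>V. ?F v)"
      hence nc: "\<not> colourable_on E L V"
        and nF: "\<And>v. v \<in> V \<Longrightarrow> c * card (?B v) \<le> card (\<Union>(L ` ?B v)) + c\<^sup>2" by auto
      \<comment> \<open>Testing whole balls suffices: a vertex of the ball outside \<open>A\<close>
        contributes at most \<open>c\<close> new colours, so \<open>A\<close> has no more
        repetitions than the ball.\<close>
      have sparse: "c * card A \<le> card (\<Union>(L ` A)) + c\<^sup>2"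
        if v: "v \<in> V" and A: "A \<subseteq> V \<inter> ?B v" for v A
      proof -
        have BV: "?B v \<subseteq> V" using ball[OF v] by blast
        hence fB: "finite (?B v)" using V finite_subset by blast
        hence fA: "finite A" using A finite_subset by blast
        have split: "?B v = A \<union> (?B v - A)" using A by blast
        have cB: "card (?B v) = card A + card (?B v - A)"
          using A fA fB by (subst split, subst card_Un_disjoint) auto
        have "\<Union>(L ` ?B v) = \<Union>(L ` A) \<union> \<Union>(L ` (?B v - A))" using A by blast
        hence "card (\<Union>(L ` ?B v)) \<le> card (\<Union>(L ` A)) + card (\<Union>(L ` (?B v - A)))"
          by (metis card_Un_le)
        also have "card (\<Union>(L ` (?B v - A))) \<le> (\<Sum>x\<in>?B v - A. card (L x))"
          using fB by (intro card_UN_le) auto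
        also have "\<dots> = (\<Sum>x\<in>?B v - A. c)"
          using supp[of L] L BV by (intro sum.cong) auto
        also have "\<dots> = c * card (?B v - A)" by simp
        finally show ?thesis using nF[OF v] unfolding cB by (simp add: algebra_simps)
      qed
      obtain X A where "X \<in> ?C" "\<And>x. x \<in> X \<Longrightarrow> L x = A"
      proof (rule noncolourable_clique_constant[OF V E(2,3) c _ _ nc])
        show "finite (L x) \<and> card (L x) = c" if "x \<in> V" for x using supp that L by blast
      qed (use sparse in blast)+
      thus False using L by auto
    qed
  qed auto
  also have "\<dots> \<le> ?P ?G + ?P (\<Union>v\<in>V. ?F v)"
    by (rule measure_Un_le) auto
  also have "?P (\<Union>v\<in>V. ?F v) \<le> (\<Sum>v\<in>V. ?P (?F v))"
    using V by (intro measure_pmf.finite_measure_subadditive_finite) auto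
  also have "\<dots> \<le> (\<Sum>v\<in>V. real (c * (c * m)) ^ (c * m) / real (card S) ^ Suc (c\<^sup>2))"
  proof (rule sum_mono)
    fix v assume v: "v \<in> V"
    show "?P (?F v) \<le> real (c * (c * m)) ^ (c * m) / real (card S) ^ Suc (c\<^sup>2)"
    proof -
      have "card (?B v) \<le> m" using ball[OF v] unfolding m_def by blast
      thus ?thesis unfolding M_def
        using ball[OF v] by (intro prob_card_Union_deficient_le[OF V _ _ S(1) S' c m1]) blast+
    qed
  qed
  finally have lower: "?P (- \<Union>(?A ` ?C)) \<le> ?P ?G +
      card V * (real (c * (c * m)) ^ (c * m) / real (card S) ^ Suc (c\<^sup>2))" by simp
  have compl: "?P (- \<Union>(?A ` ?C)) = 1 - ?P (\<Union>(?A ` ?C))"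
    using measure_pmf.prob_compl[of "\<Union>(?A ` ?C)" M] by (simp add: Compl_eq_Diff_UNIV)
  have "\<bar>1 - ?P (\<Union>(?A ` ?C)) - exp (- (N / b ^ c))\<bar>
      \<le> N * (d / b ^ Suc c + (d + 1) * (1 / b ^ c)\<^sup>2)"
    unfolding M_def b_def N_def d_def by (rule prob_no_constant_clique[OF V E(1) deg S(1) S'(1)])
  moreover have "0 \<le> card V * (real (c * (c * m)) ^ (c * m) / real (card S) ^ Suc (c\<^sup>2))"
    by (intro mult_nonneg_nonneg divide_nonneg_nonneg) auto
  ultimately show ?thesis using upper lower unfolding compl by linarith
qed

subsection \<open>Powers of cycles\<close>

text \<open>For \<open>i, j < n\<close> this is the residue of \<open>j - i\<close> modulo
  \<open>n\<close>, with a case split in place of \<open>mod\<close> so that linear arithmetic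
  applies.\<close>

definition clockwise :: "nat \<Rightarrow> nat \<Rightarrow> nat \<Rightarrow> nat" where
  "clockwise n i j = (if i \<le> j then j - i else j + n - i)"

lemma int_clockwise:
  assumes "i < n" "j < n"
  shows "(int j - int i) mod int n = int (clockwise n i j)"
proof (cases "i \<le> j")
  case True
  thus ?thesis using assms by (simp add: clockwise_def of_nat_diff)
next
  case False
  have "(int j - int i) mod int n = (int j - int i + int n) mod int n" by simp
  also have "\<dots> = int j - int i + int n"
    using False assms by (intro mod_pos_pos_trivial) auto
  finally show ?thesis using False assms by (simp add: clockwise_def of_nat_diff)
qed

lemma parcs_cycle_power_iff:
  assumes "k < n"
  shows "(i, j) \<in> parcs (cycle_power n k) \<longleftrightarrow>
     i < n \<and> j < n \<and> i \<noteq> j \<and> (clockwise n i j \<le> k \<or> clockwise n j i \<le> k)"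
proof -
  have "(int i - int j) mod int n \<in> (\<lambda>d. d mod int n) ` ({- int k..-1} \<union> {1..int k}) \<longleftrightarrow>
      clockwise n i j \<le> k \<or> clockwise n j i \<le> k" if ij: "i < n" "j < n" "i \<noteq> j"
  proof -
    have neg: "(\<lambda>d. d mod int n) ` {- int k..-1} = {int n - int k..int n - 1}"
    proof -
      have "d mod int n = d + int n" if "d \<in> {- int k..-1}" for d
      proof -
        have "d mod int n = (d + int n) mod int n" by simp
        also have "\<dots> = d + int n" using that assms by (intro mod_pos_pos_trivial) auto
        finally show ?thesis .
      qed
      hence "(\<lambda>d. d mod int n) ` {- int k..-1} = (\<lambda>d. d + int n) ` {- int k..-1}" by simp
      thus ?thesis by simp
    qed
    have pos: "(\<lambda>d. d mod int n) ` {1..int k} = {1..int k}" using assms by simp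
    have "(int i - int j) mod int n \<in> (\<lambda>d. d mod int n) ` ({- int k..-1} \<union> {1..int k}) \<longleftrightarrow>
        clockwise n j i \<in> {n - k..n - 1} \<union> {1..k}"
      unfolding image_Un neg pos int_clockwise[OF ij(2,1)] using assms by auto
    \<comment> \<open>For distinct vertices the two clockwise distances add up to \<open>n\<close>,
      so \<open>n - k..n - 1\<close> for one is \<open>1..k\<close> for the other.\<close>
    also have "\<dots> \<longleftrightarrow> clockwise n i j \<le> k \<or> clockwise n j i \<le> k"
      using ij assms by (auto simp: clockwise_def)
    finally show ?thesis .
  qed
  thus ?thesis by (auto simp: cycle_power_def)
qed

lemma pverts_cycle_power [simp]: "pverts (cycle_power n k) = {0..<n}"
  by (simp add: cycle_power_def)

lemma parcs_cycle_power_subset: "parcs (cycle_power n k) \<subseteq> {0..<n} \<times> {0..<n}"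
  by (auto simp: cycle_power_def)

lemma sym_parcs_cycle_power: "k < n \<Longrightarrow> sym (parcs (cycle_power n k))"
  by (auto simp: sym_def parcs_cycle_power_iff)

lemma irrefl_parcs_cycle_power: "irrefl (parcs (cycle_power n k))"
  by (auto simp: irrefl_def cycle_power_def)

lemma degree_cycle_power_le: 
  assumes "k < n"
  shows "card (parcs (cycle_power n k) `` {v}) \<le> 2 * k"
proof -
  let ?f = "\<lambda>d. nat ((int v + d) mod int n)"
  have "parcs (cycle_power n k) `` {v} \<subseteq> ?f ` ({- int k..-1} \<union> {1..int k})"
  proof
    fix w assume "w \<in> parcs (cycle_power n k) `` {v}"
    hence w: "v < n" "w < n" "v \<noteq> w" "clockwise n v w \<le> k \<or> clockwise n w v \<le> k"
      using parcs_cycle_power_iff[OF assms] by auto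
    have ne: "clockwise n v w \<ge> 1" "clockwise n w v \<ge> 1" using w(1-3) by (auto simp: clockwise_def)
    have "(int v + int (clockwise n v w)) mod int n = int w"
      unfolding int_clockwise[OF w(1,2), symmetric] using w(2) by (simp add: mod_add_right_eq)
    moreover have "(int v - int (clockwise n w v)) mod int n = int w"
      unfolding int_clockwise[OF w(2,1), symmetric] using w(2) by (simp add: mod_diff_right_eq)
    ultimately have "w = ?f (int (clockwise n v w))" "w = ?f (- int (clockwise n w v))" by simp_all
    thus "w \<in> ?f ` ({- int k..-1} \<union> {1..int k})"
      using w(4) ne by (elim disjE) (rule image_eqI, assumption, simp)+
  qed
  hence "card (parcs (cycle_power n k) `` {v}) \<le> card (?f ` ({- int k..-1} \<union> {1..int k}))"
    by (intro card_mono) auto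
  also have "\<dots> \<le> card ({- int k..-1} \<union> {1..int k})" by (intro card_image_le) auto
  also have "\<dots> \<le> card {- int k..-1} + card {1..int k}" by (rule card_Un_le)
  also have "\<dots> = 2 * k" by simp
  finally show ?thesis .
qed

lemma list_colourable_cycle_power_iff:
  "list_colourable (cycle_power n k) L \<longleftrightarrow> colourable_on (parcs (cycle_power n k)) L {0..<n}"
  unfolding list_colourable_def is_list_colouring_def colourable_on_def
  using parcs_cycle_power_subset[of n k] by (intro ex_cong1) (auto simp: cycle_power_def)

text \<open>Without a first vertex a clique would have to wrap around the cycle, closing it up by
  three arcs of length at most \<open>k\<close>; \<open>3 * k < n\<close> forbids this.\<close>

lemma clique_cycle_power_leftmost:
  assumes n: "3 * k < n" and X: "X \<in> cliques (parcs (cycle_power n k)) {0..<n} m" and m: "m \<ge> 1"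
  obtains x where "x \<in> X" "\<And>y. y \<in> X \<Longrightarrow> clockwise n x y \<le> k"
proof -
  have kn: "k < n" using n by simp
  have lt: "x < n" if "x \<in> X" for x using that X by (auto simp: cliques_def)
  have adj: "clockwise n x y \<le> k \<or> clockwise n y x \<le> k" if "x \<in> X" "y \<in> X" for x y
  proof (cases "x = y")
    case True
    thus ?thesis by (simp add: clockwise_def)
  next
    case False
    thus ?thesis using that X parcs_cycle_power_iff[OF kn, of x y] by (auto simp: cliques_def)
  qed
  have "X \<noteq> {}" "finite X" using X m by (auto simp: cliques_def intro: finite_subset[of X "{0..<n}"])
  then obtain x0 where x0: "x0 \<in> X" by blast
  \<comment> \<open>The first vertex is the one farthest behind \<open>x0\<close> among those at
    most \<open>k\<close> behind it.\<close>
  let ?Y = "{x \<in> X. clockwise n x x0 \<le> k}"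
  have "x0 \<in> ?Y" using x0 by (simp add: clockwise_def)
  moreover have "finite ?Y" using \<open>finite X\<close> by simp
  ultimately have "Max ((\<lambda>x. clockwise n x x0) ` ?Y) \<in> (\<lambda>x. clockwise n x x0) ` ?Y"
    by (intro Max_in) auto
  then obtain x where x: "x \<in> ?Y" "clockwise n x x0 = Max ((\<lambda>x. clockwise n x x0) ` ?Y)"
    by fastforce
  have max: "clockwise n y x0 \<le> clockwise n x x0" if "y \<in> ?Y" for y
    unfolding x(2) using that \<open>finite ?Y\<close> by (intro Max_ge) auto
  have "clockwise n x y \<le> k" if y: "y \<in> X" for y
  proof (rule ccontr)
    assume far: "\<not> clockwise n x y \<le> k"
    hence yx: "clockwise n y x \<le> k" using adj x y by blast
    have bounds: "x < n" "y < n" "x0 < n" using lt x y x0 by auto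
    have ne: "x \<noteq> y" using far by (auto simp: clockwise_def)
    have xx0: "clockwise n x x0 \<le> k" using x by simp
    have sum: "clockwise n y x0 = clockwise n y x + clockwise n x x0"
      using bounds yx xx0 n unfolding clockwise_def by (auto split: if_splits)
    \<comment> \<open>The arc from \<open>y\<close> through \<open>x\<close> to \<open>x0\<close>
      has length at most \<open>2 * k\<close>. Were the way back from \<open>x0\<close> to
      \<open>y\<close> at most \<open>k\<close>, distinct \<open>x0\<close> and \<open>y\<close>
      would give a full turn of length at most \<open>3 * k < n\<close>. So \<open>y\<close> is at
      most \<open>k\<close> behind \<open>x0\<close>, and farther behind than \<open>x\<close>,
      against maximality.\<close>
    have "clockwise n x0 y \<le> k \<or> clockwise n y x0 \<le> k" using adj x0 y by blast
    moreover have "clockwise n x0 y + clockwise n y x0 = 0 \<or> clockwise n x0 y + clockwise n y x0 = n"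
      using bounds by (auto simp: clockwise_def)
    ultimately have "clockwise n y x0 \<le> k" using sum yx xx0 n by linarith
    hence "clockwise n y x0 \<le> clockwise n x x0" using max y by simp
    hence "clockwise n y x = 0" using sum by simp
    thus False using bounds ne by (simp add: clockwise_def split: if_splits)
  qed
  thus ?thesis using that x by blast
qed

lemma card_cliques_cycle_power:
  assumes n: "3 * k < n"
  shows "card (cliques (parcs (cycle_power n k)) {0..<n} (Suc c)) = n * (k choose c)"
proof -
  let ?C = "cliques (parcs (cycle_power n k)) {0..<n} (Suc c)"
  let ?I = "{0..<n} \<times> nsubsets_of {1..k} c"
  \<comment> \<open>\<open>\<phi> i D\<close> is the clique with first vertex \<open>i\<close> and clockwise offsets \<open>D\<close>. It determines \<open>i\<close>
    because \<open>2 k < n\<close>; every clique has this form because \<open>3 k < n\<close>.\<close>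
  define r where "r = (\<lambda>i d. if i + d < n then i + d else i + d - n)"
  define \<phi> where "\<phi> = (\<lambda>i D. insert i (r i ` D))"
  have kn: "k < n" using n by simp
  have r: "r i d < n" "clockwise n i (r i d) = d" "r i d \<noteq> i"
    if "i < n" "d \<in> {1..k}" for i d
    using that n by (auto simp: clockwise_def r_def)
  have cw_\<phi>: "clockwise n i ` \<phi> i D = insert 0 D" if "(i, D) \<in> ?I" for i D
  proof -
    have iD: "i < n" "D \<subseteq> {1..k}" using that by (auto simp: nsubsets_of_def)
    have "clockwise n i (r i d) = d" if "d \<in> D" for d using r(2) iD that by blast
    hence "clockwise n i ` r i ` D = D" unfolding image_image by simp
    moreover have "clockwise n i i = 0" by (simp add: clockwise_def)
    ultimately show ?thesis by (simp add: \<phi>_def)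
  qed
  have near_\<phi>: "clockwise n i y \<le> k" if "(i, D) \<in> ?I" "y \<in> \<phi> i D" for i D y
  proof -
    have "clockwise n i y \<in> insert 0 D"
      using imageI[OF that(2), of "clockwise n i"] unfolding cw_\<phi>[OF that(1)] .
    thus ?thesis using that(1) by (auto simp: nsubsets_of_def)
  qed
  have \<phi>_eqD: "i = j \<and> D = D'"
    if I: "(i, D) \<in> ?I" "(j, D') \<in> ?I" and eq: "\<phi> i D = \<phi> j D'" for i j D D'
  proof
    have "j \<in> \<phi> j D'" "i \<in> \<phi> i D" by (simp_all add: \<phi>_def)
    hence "clockwise n i j \<le> k" "clockwise n j i \<le> k"
      using near_\<phi>[OF I(1), of j] near_\<phi>[OF I(2), of i] by (simp_all add: eq)
    moreover have "i < n" "j < n" using I by simp_all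
    ultimately show ij: "i = j" using n by (simp add: clockwise_def split: if_splits)
    have "insert 0 D = insert 0 D'" by (metis cw_\<phi>[OF I(1)] cw_\<phi>[OF I(2)] eq ij)
    moreover have "0 \<notin> D" "0 \<notin> D'" using I by (auto simp: nsubsets_of_def)
    ultimately show "D = D'" by (simp add: insert_ident)
  qed
  have inj: "inj_on (\<lambda>(i, D). \<phi> i D) ?I"
  proof (rule inj_onI)
    fix p q assume "p \<in> ?I" "q \<in> ?I" "(\<lambda>(i, D). \<phi> i D) p = (\<lambda>(i, D). \<phi> i D) q"
    thus "p = q" using \<phi>_eqD[of "fst p" "snd p" "fst q" "snd q"]
      by (simp add: case_prod_unfold prod_eq_iff)
  qed
  have img: "(\<lambda>(i, D). \<phi> i D) ` ?I = ?C"
  proof (intro equalityI subsetI)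
    fix X assume "X \<in> (\<lambda>(i, D). \<phi> i D) ` ?I"
    then obtain i D where iD: "(i, D) \<in> ?I" and X: "X = \<phi> i D" by auto
    have i: "i < n" and D: "D \<subseteq> {1..k}" "card D = c" using iD by (auto simp: nsubsets_of_def)
    have fD: "finite D" using D finite_subset by blast
    have "inj_on (r i) D"
    proof (rule inj_on_inverseI)
      show "clockwise n i (r i d) = d" if "d \<in> D" for d using r(2)[OF i] D that by blast
    qed
    moreover have "r i d \<noteq> i" if "d \<in> D" for d using r(3)[OF i, of d] D(1) that by blast
    hence "i \<notin> r i ` D" by (metis imageE)
    ultimately have card: "card X = Suc c" unfolding X \<phi>_def using fD D by (simp add: card_image)
    have sub: "x < n" if "x \<in> X" for x
    proof -
      have "x = i \<or> (\<exists>d\<in>D. x = r i d)" using that by (auto simp: X \<phi>_def)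
      thus ?thesis using r(1)[OF i] i D(1) by (metis subsetD)
    qed
    have "(x, y) \<in> parcs (cycle_power n k)" if xy: "x \<in> X" "y \<in> X" "x \<noteq> y" for x y
    proof -
      have near: "clockwise n i x \<le> k" "clockwise n i y \<le> k" using near_\<phi>[OF iD] xy(1,2) unfolding X by simp_all
      \<comment> \<open>Of two vertices on the arc of length \<open>k\<close> starting at
        \<open>i\<close>, the one nearer to \<open>i\<close> reaches the other within the difference
        of their offsets.\<close>
      have "clockwise n x y \<le> k \<or> clockwise n y x \<le> k"
        using near i sub[OF xy(1)] sub[OF xy(2)] n unfolding clockwise_def by (auto split: if_splits)
      thus ?thesis using parcs_cycle_power_iff[OF kn, of x y] sub[of x] sub[of y] xy by simp
    qed
    thus "X \<in> ?C" using card sub by (auto simp: cliques_def)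
  next
    fix X assume X: "X \<in> ?C"
    then obtain x where x: "x \<in> X" "\<And>y. y \<in> X \<Longrightarrow> clockwise n x y \<le> k"
      using clique_cycle_power_leftmost[OF n X] by auto
    have lt: "y < n" if "y \<in> X" for y using that X by (auto simp: cliques_def)
    have cX: "card X = Suc c" "finite X"
      using X by (auto simp: cliques_def intro: finite_subset[of X "{0..<n}"])
    \<comment> \<open>The preimage of \<open>X\<close> consists of its first vertex and the offsets
      of the others, which \<open>r x\<close> turns back into vertices.\<close>
    let ?D = "clockwise n x ` (X - {x})"
    have r_cw: "r x (clockwise n x y) = y" if "y \<in> X" for y
      using lt[OF that] lt[OF x(1)] by (auto simp: clockwise_def r_def)
    hence "inj_on (clockwise n x) (X - {x})" by (intro inj_on_inverseI[of _ "r x"]) auto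
    hence "card ?D = c" using cX x(1) by (simp add: card_image)
    moreover have "?D \<subseteq> {1..k}"
    proof
      fix d assume "d \<in> ?D"
      then obtain y where y: "y \<in> X" "y \<noteq> x" "d = clockwise n x y" by blast
      have "d \<noteq> 0" using y lt[OF y(1)] lt[OF x(1)] by (auto simp: clockwise_def)
      thus "d \<in> {1..k}" using x(2)[OF y(1)] y by simp
    qed
    ultimately have "(x, ?D) \<in> ?I" using lt x(1) by (simp add: nsubsets_of_def)
    moreover have "X = (\<lambda>(i, D). \<phi> i D) (x, ?D)"
    proof -
      have "r x ` ?D = X - {x}" unfolding image_image using r_cw by simp
      hence "\<phi> x ?D = insert x (X - {x})" by (simp only: \<phi>_def)
      thus ?thesis by (simp only: prod.case insert_Diff[OF x(1)])
    qed
    ultimately show "X \<in> (\<lambda>(i, D). \<phi> i D) ` ?I" by (rule rev_image_eqI)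
  qed
  have "card ?C = card ?I" using card_image[OF inj] unfolding img .
  thus ?thesis by (simp add: card_cartesian_product card_nsubsets_of)
qed

subsection \<open>The limit\<close>

text \<open>The quotient is the product of the factors \<open>1 - i / s n\<close> for
  \<open>i < c\<close>, divided by \<open>fact c\<close>, and each of these finitely many factors
  tends to 1.\<close>

lemma choose_over_power_tendsto:
  assumes "filterlim s at_top F"
  shows "((\<lambda>n. real (s n choose c) / real (s n) ^ c) \<longlongrightarrow> 1 / fact c) F"
proof -
  have lim: "((\<lambda>n. 1 / real (s n)) \<longlongrightarrow> 0) F"
    by (rule tendsto_divide_0[OF tendsto_const])
       (intro filterlim_at_top_imp_at_infinity filterlim_compose[OF filterlim_real_sequentially assms])
  have "((\<lambda>n. (\<Prod>i=0..<c. 1 - real i * (1 / real (s n))) / fact c) \<longlongrightarrow>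
      (\<Prod>i=0..<c. 1 - real i * 0) / fact c) F"
    by (intro tendsto_intros lim) auto
  moreover have "\<forall>\<^sub>F n in F. (\<Prod>i=0..<c. 1 - real i * (1 / real (s n))) / fact c =
      real (s n choose c) / real (s n) ^ c"
  proof -
    have "\<forall>\<^sub>F n in F. 1 \<le> s n" using assms by (simp add: filterlim_at_top)
    thus ?thesis
    proof eventually_elim
      case (elim n)
      have "real (s n choose c) = (\<Prod>i=0..<c. real (s n) - real i) / fact c"
        by (simp add: binomial_gbinomial gbinomial_prod_rev)
      also have "(\<Prod>i=0..<c. real (s n) - real i) =
          (\<Prod>i=0..<c. real (s n) * (1 - real i * (1 / real (s n))))"
        using elim by (intro prod.cong) (auto simp: field_simps)
      also have "\<dots> = real (s n) ^ c * (\<Prod>i=0..<c. 1 - real i * (1 / real (s n)))"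
        by (simp add: prod.distrib)
      finally show ?case using elim by simp
    qed
  qed
  ultimately show ?thesis by (simp add: tendsto_cong)
qed

theorem theorem2p3:
  fixes c k :: nat and t :: real and s :: "nat \<Rightarrow> nat" and S :: "nat \<Rightarrow> 'a set"
  assumes "c \<ge> 1" and "k \<ge> 1" and "c \<le> k" and "t > 0"
    and "\<And>n. n \<ge> 1 \<Longrightarrow> s n \<ge> c"
    and "\<And>n. n \<ge> 1 \<Longrightarrow> finite (S n) \<and> card (S n) = s n"
    and "(\<lambda>n. real (s n)) \<sim>[at_top] (\<lambda>n. t * real n powr (1 / real (c ^ 2)))"
  shows "(\<lambda>n. colourable_prob n c k (S n)) \<longlonglongrightarrow>
           exp (- (real (k choose c) * t powi (- int (c ^ 2)) * fact c ^ c))"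
proof -
  note c = assms(1) and t = assms(4) and S = assms(6)
  have c2: "c\<^sup>2 > 0" using c by simp
  have scale: "filterlim (\<lambda>n. t * real n powr (1 / real (c\<^sup>2))) at_top at_top"
    using t c2 by (intro filterlim_tendsto_pos_mult_at_top[OF tendsto_const]
      filterlim_compose[OF real_powr_at_top filterlim_real_sequentially]) auto
  have s_real: "filterlim (\<lambda>n. real (s n)) at_top at_top"
    using asymp_equiv_at_top_transfer[OF asymp_equiv_symI[OF assms(7)] scale] .
  hence s_top: "filterlim s at_top at_top"
    by (simp only: filterlim_sequentially_iff_filterlim_real)
  have inv_s: "(\<lambda>n. 1 / real (s n)) \<longlonglongrightarrow> 0"
    by (rule tendsto_divide_0[OF tendsto_const]) (rule filterlim_at_top_imp_at_infinity[OF s_real])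
  have s_pos: "\<forall>\<^sub>F n in sequentially. s n \<ge> 1" using s_top by (simp add: filterlim_at_top)

  \<comment> \<open>\<open>x\<close> carries the assumption on \<open>s\<close>, and
    \<open>y\<close> below the comparison of \<open>s n choose c\<close> with
    \<open>s n ^ c\<close>; the limiting exponent is assembled from the two.\<close>
  define x where "x = (\<lambda>n. real n / real (s n) ^ (c\<^sup>2))"
  have x_lim: "x \<longlonglongrightarrow> 1 / t ^ (c\<^sup>2)"
  proof -
    have "(\<lambda>n. real (s n) / (t * real n powr (1 / real (c\<^sup>2)))) \<longlonglongrightarrow> 1"
      by (rule asymp_equivD_strong[OF assms(7)]) (use s_pos in \<open>auto elim: eventually_mono\<close>)
    \<comment> \<open>Raising to the power \<open>c\<^sup>2\<close> cancels the root of
      \<open>n\<close>, so this expression is eventually \<open>x n\<close>.\<close>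
    hence "(\<lambda>n. 1 / (t ^ (c\<^sup>2) * (real (s n) / (t * real n powr (1 / real (c\<^sup>2)))) ^ (c\<^sup>2))) \<longlonglongrightarrow>
        1 / (t ^ (c\<^sup>2) * 1 ^ (c\<^sup>2))"
      using t by (intro tendsto_intros) auto
    moreover have "\<forall>\<^sub>F n in sequentially.
        1 / (t ^ (c\<^sup>2) * (real (s n) / (t * real n powr (1 / real (c\<^sup>2)))) ^ (c\<^sup>2)) = x n"
      using s_pos eventually_gt_at_top[of 0]
    proof eventually_elim
      case (elim n)
      have "(real n powr (1 / real (c\<^sup>2))) ^ (c\<^sup>2) = real n"
        using elim c2 by (simp add: powr_realpow[symmetric] powr_powr del: of_nat_power)
      thus ?case using t elim by (simp add: x_def power_divide power_mult_distrib)
    qed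
    ultimately show ?thesis by (simp add: tendsto_cong)
  qed

  define b where "b = (\<lambda>n. real (s n choose c))"
  define y where "y = (\<lambda>n. real (s n) ^ c / b n)"
  have y_lim: "y \<longlonglongrightarrow> fact c"
  proof -
    have "(\<lambda>n. inverse (b n / real (s n) ^ c)) \<longlonglongrightarrow> inverse (1 / fact c)"
      unfolding b_def by (intro tendsto_inverse choose_over_power_tendsto[OF s_top]) auto
    thus ?thesis by (simp add: y_def)
  qed
  have inv_b: "(\<lambda>n. 1 / b n) \<longlonglongrightarrow> 0"
  proof -
    have "(\<lambda>n. y n * (1 / real (s n)) ^ c) \<longlonglongrightarrow> fact c * 0 ^ c"
      by (intro tendsto_intros y_lim inv_s)
    moreover have "\<forall>\<^sub>F n in sequentially. y n * (1 / real (s n)) ^ c = 1 / b n"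
      using s_pos by eventually_elim (simp add: y_def power_divide)
    ultimately show ?thesis using c by (simp add: tendsto_cong power_0_left)
  qed

  \<comment> \<open>For \<open>n > 3 * k\<close> this is the number of cliques of size
    \<open>c + 1\<close>, and \<open>N n / b n ^ c\<close> is the expected number of constant
    ones.\<close>
  define N where "N = (\<lambda>n. real (n * (k choose c)))"
  have rate: "(\<lambda>n. N n / b n ^ c) \<longlonglongrightarrow> real (k choose c) * t powi (- int (c ^ 2)) * fact c ^ c"
  proof -
    have "(\<lambda>n. real (k choose c) * x n * y n ^ c) \<longlonglongrightarrow>
        real (k choose c) * (1 / t ^ (c\<^sup>2)) * fact c ^ c"
      by (intro tendsto_intros x_lim y_lim)
    moreover have "\<forall>\<^sub>F n in sequentially. real (k choose c) * x n * y n ^ c = N n / b n ^ c"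
      using s_pos
    proof eventually_elim
      case (elim n)
      have "real (s n) ^ (c\<^sup>2) = (real (s n) ^ c) ^ c"
        by (simp add: power2_eq_square flip: power_mult)
      thus ?case using elim by (simp add: x_def y_def N_def power_divide)
    qed
    ultimately have "(\<lambda>n. N n / b n ^ c) \<longlonglongrightarrow>
        real (k choose c) * (1 / t ^ (c\<^sup>2)) * fact c ^ c" by (simp add: tendsto_cong)
    moreover have "t powi (- int (c ^ 2)) = 1 / t ^ (c\<^sup>2)"
      by (simp only: power_int_minus power_int_of_nat inverse_eq_divide)
    ultimately show ?thesis by (simp only:)
  qed

  \<comment> \<open>The constants of \<open>prob_colourable_on_near_exp\<close> for degree bound
    \<open>D = 2 * k\<close>; they do not depend on \<open>n\<close>.\<close>
  define d where "d = Suc c * 2 ^ (2 * k + 1)"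
  define m where "m = (2 * k + 1) ^ Suc (c\<^sup>2)"
  define K where "K = real (c * (c * m)) ^ (c * m)"
  define err where "err = (\<lambda>n. N n * (d / b n ^ Suc c + (d + 1) * (1 / b n ^ c)\<^sup>2)
        + n * (K / real (s n) ^ Suc (c\<^sup>2)))"
  have err_lim: "err \<longlonglongrightarrow> 0"
  proof -
    let ?l = "real (k choose c) * t powi (- int (c ^ 2)) * fact c ^ c"
    \<comment> \<open>The convergent quantities \<open>N n / b n ^ c\<close> and \<open>x n\<close>
      are factored out of \<open>err\<close>. What remains are positive powers of
      \<open>1 / b n\<close> and the factor \<open>1 / s n\<close>, gained from the exponent
      \<open>c\<^sup>2 + 1\<close> in place of \<open>c\<^sup>2\<close>.\<close>
    have "(\<lambda>n. N n / b n ^ c * (d * (1 / b n) + (d + 1) * (1 / b n) ^ c) + K * x n * (1 / real (s n)))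
        \<longlonglongrightarrow> ?l * (real d * 0 + real (d + 1) * 0 ^ c) + K * (1 / t ^ (c\<^sup>2)) * 0"
      by (intro tendsto_intros rate inv_b x_lim inv_s)
    moreover have "(\<lambda>n. N n / b n ^ c * (d * (1 / b n) + (d + 1) * (1 / b n) ^ c) + K * x n * (1 / real (s n)))
        = err"
      by (rule ext) (simp add: err_def x_def power_divide power2_eq_square algebra_simps)
    ultimately show ?thesis using c by (simp add: power_0_left)
  qed

  have close: "\<forall>\<^sub>F n in sequentially.
      \<bar>colourable_prob n c k (S n) - exp (- (N n / b n ^ c))\<bar> \<le> err n"
  proof -
    have "\<forall>\<^sub>F n in sequentially. s n \<ge> c * m" using s_top by (simp add: filterlim_at_top)
    thus ?thesis using eventually_gt_at_top[of "3 * k"]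
    proof eventually_elim
      case (elim n)
      let ?E = "parcs (cycle_power n k)"
      have kn: "k < n" "n \<ge> 1" using elim by auto
      note Sn = S[OF kn(2)]
      have "\<bar>measure_pmf.prob (Pi_pmf {0..<n} {} (\<lambda>_. pmf_of_set (nsubsets_of (S n) c)))
               {L. colourable_on ?E L {0..<n}}
             - exp (- (card (cliques ?E {0..<n} (Suc c)) / real (card (S n) choose c) ^ c))\<bar>
        \<le> card (cliques ?E {0..<n} (Suc c)) *
            (d / real (card (S n) choose c) ^ Suc c
               + (d + 1) * (1 / real (card (S n) choose c) ^ c)\<^sup>2)
           + card {0..<n} * (K / real (card (S n)) ^ Suc (c\<^sup>2))"
        unfolding d_def K_def m_def
      proof (rule prob_colourable_on_near_exp)
        show "sym ?E" by (rule sym_parcs_cycle_power[OF kn(1)])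
        show "card (?E `` {v}) \<le> 2 * k" for v by (rule degree_cycle_power_le[OF kn(1)])
        show "c * (2 * k + 1) ^ Suc (c\<^sup>2) \<le> card (S n)" using elim Sn unfolding m_def by simp
      qed (use Sn c parcs_cycle_power_subset irrefl_parcs_cycle_power in auto)
      moreover have "colourable_prob n c k (S n) =
          measure_pmf.prob (Pi_pmf {0..<n} {} (\<lambda>_. pmf_of_set (nsubsets_of (S n) c)))
            {L. colourable_on ?E L {0..<n}}"
        by (simp add: colourable_prob_def random_lists_def list_colourable_cycle_power_iff
            nsubsets_of_def)
      ultimately show ?case
        using card_cliques_cycle_power[OF elim(2), of c] Sn by (simp add: err_def N_def b_def)
    qed
  qed
  have "(\<lambda>n. colourable_prob n c k (S n) - exp (- (N n / b n ^ c))) \<longlonglongrightarrow> 0"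
    by (rule Lim_null_comparison[OF _ err_lim]) (use close in simp)
  from tendsto_add[OF this tendsto_exp[OF tendsto_minus[OF rate]]] show ?thesis by simp
qed

end
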